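(* Let $p$ be an odd prime, let $G=C_p$ be the cyclic group of order $p$, and let $V$ be a finite-dimensional representation of $G$ over $\mathbb{C}$ with character $\chi$. Let $\mathbb{Q}(\chi)$ be the field generated over $\mathbb{Q}$ by the values of $\chi$. Then $$\beta_{\mathrm{field}}(G,V) \leq 2[\mathbb{Q}(\chi):\mathbb{Q}]+1.$$
   Context: $\mathbb{C}[V]$ is the ring of polynomial functions on $V$ (the symmetric algebra of $V^*$), with $G$-action $(gf)(v)=f(g^{-1}v)$; $\mathbb{C}(V)$ is its fraction field and $\mathbb{C}(V)^G$ the field of $G$-invariant rational functions; $\mathbb{C}[V]^G_{\le d}$ is the space of $G$-invariant polynomials of degree at most $d$. The field Noether number $\beta_{\mathrm{field}}(G,V)$ is the minimum $d\in\mathbb{N}=\{0,1,2,\dots\}$ such that $\mathbb{C}(V)^G$ is generated, as a field extension of $\mathbb{C}$, by $\mathbb{C}[V]^G_{\le d}$. *)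

theory Defs
  imports
    Complex_Main
    "HOL-Computational_Algebra.Polynomial"
    "HOL-Computational_Algebra.Fraction_Field"
    "HOL-Algebra.Group_Action"
    "HOL-Algebra.Elementary_Groups"
    "HOL-Algebra.Generated_Fields"
    "HOL-Algebra.Algebraic_Closure_Type"
begin

text \<open>A type class rather than the locale \<^locale>\<open>vector_space\<close>, so that the polynomial functions
  on the space form a type, to which \<^typ>\<open>'a fract\<close> applies. The zero space is admitted.\<close>

class complex_vector = ab_group_add +
  fixes scaleC :: "complex \<Rightarrow> 'a \<Rightarrow> 'a"  (infixr \<open>*\<^sub>C\<close> 75)
  assumes scaleC_add_right: "a *\<^sub>C (x + y) = a *\<^sub>C x + a *\<^sub>C y"
    and scaleC_add_left: "(a + b) *\<^sub>C x = a *\<^sub>C x + b *\<^sub>C x"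
    and scaleC_scaleC: "a *\<^sub>C (b *\<^sub>C x) = (a * b) *\<^sub>C x"
    and scaleC_one: "1 *\<^sub>C x = x"

global_interpretation cvec: vector_space "scaleC :: complex \<Rightarrow> 'a \<Rightarrow> 'a::complex_vector"
  by unfold_locales (simp_all add: scaleC_add_right scaleC_add_left scaleC_scaleC scaleC_one)

abbreviation clinear :: "('a::complex_vector \<Rightarrow> 'b::complex_vector) \<Rightarrow> bool" where
  "clinear \<equiv> Vector_Spaces.linear scaleC scaleC"

abbreviation linear_form :: "('a::complex_vector \<Rightarrow> complex) \<Rightarrow> bool" where
  "linear_form \<equiv> Vector_Spaces.linear scaleC (*)"

definition finite_dim :: "'a::complex_vector itself \<Rightarrow> bool" where
  "finite_dim _ \<longleftrightarrow> (\<exists>B :: 'a set. finite B \<and> cvec.span B = UNIV)"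

text \<open>The basis is an arbitrary one; by \<open>ctrace_eq\<close> below the choice is immaterial.\<close>

definition ctrace :: "('a::complex_vector \<Rightarrow> 'a) \<Rightarrow> complex" where
  "ctrace T = (let B = cvec.extend_basis {} in \<Sum>b\<in>B. cvec.representation B (T b) b)"

text \<open>The polynomial functions of degree at most \<open>d\<close>: the linear span of the products of at most
  \<open>d\<close> linear forms.\<close>

inductive polynomial_upto :: "nat \<Rightarrow> ('a::complex_vector \<Rightarrow> complex) \<Rightarrow> bool" where
  const: "polynomial_upto d (\<lambda>_. c)"
| add: "polynomial_upto d f \<Longrightarrow> polynomial_upto d g \<Longrightarrow> polynomial_upto d (\<lambda>v. f v + g v)"
| mult: "linear_form l \<Longrightarrow> polynomial_upto d f \<Longrightarrow> polynomial_upto (Suc d) (\<lambda>v. l v * f v)"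

lemma polynomial_upto_mono:
  assumes "polynomial_upto d f" "d \<le> e" shows "polynomial_upto e f"
  using assms
proof (induction arbitrary: e rule: polynomial_upto.induct)
  case (mult l d f)
  then obtain e' where "e = Suc e'" "d \<le> e'" by (cases e) auto
  then show ?case using mult by (auto intro: polynomial_upto.mult)
qed (auto intro: polynomial_upto.intros)

lemma polynomial_upto_add:
  "polynomial_upto d f \<Longrightarrow> polynomial_upto e g \<Longrightarrow> polynomial_upto (max d e) (\<lambda>v. f v + g v)"
  by (rule polynomial_upto.add) (auto elim: polynomial_upto_mono)

lemma polynomial_upto_scale:
  "polynomial_upto d f \<Longrightarrow> polynomial_upto d (\<lambda>v. c * f v)"
proof (induction rule: polynomial_upto.induct)
  case (const d k)
  show ?case by (rule polynomial_upto.const)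
next
  case (add d f g)
  then show ?case by (auto simp: distrib_left intro: polynomial_upto.add)
next
  case (mult l d f)
  then show ?case
    using polynomial_upto.mult[of l d "\<lambda>v. c * f v"] by (simp add: mult.left_commute)
qed

lemma polynomial_upto_mult:
  "polynomial_upto d f \<Longrightarrow> polynomial_upto e g \<Longrightarrow> polynomial_upto (d + e) (\<lambda>v. f v * g v)"
proof (induction rule: polynomial_upto.induct)
  case (const d c)
  then show ?case
    using polynomial_upto_mono[OF polynomial_upto_scale[of e g c]] by simp
next
  case (add d f f')
  then show ?case by (auto simp: distrib_right intro: polynomial_upto.add)
next
  case (mult l d f)
  then show ?case
    using polynomial_upto.mult[of l "d + e" "\<lambda>v. f v * g v"] by (simp add: mult.assoc)
qed

lemma polynomial_upto_compose:
  assumes "clinear T"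
  shows "polynomial_upto d f \<Longrightarrow> polynomial_upto d (\<lambda>v. f (T v))"
proof (induction rule: polynomial_upto.induct)
  case (mult l d f)
  have "linear_form (\<lambda>v. l (T v))"
    using Vector_Spaces.linear_compose[OF assms mult(1)] by (simp add: o_def)
  then show ?case using mult by (auto intro: polynomial_upto.mult)
qed (auto intro: polynomial_upto.intros)

lemma polynomial_upto_line:
  "polynomial_upto d f \<Longrightarrow> \<exists>q. \<forall>t. f (u + t *\<^sub>C w) = poly q t"
proof (induction rule: polynomial_upto.induct)
  case (const d c)
  show ?case by (rule exI[of _ "[:c:]"]) simp
next
  case (add d f g)
  then obtain q r where "\<forall>t. f (u + t *\<^sub>C w) = poly q t" "\<forall>t. g (u + t *\<^sub>C w) = poly r t" by blast
  then show ?case by (intro exI[of _ "q + r"]) simp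
next
  case (mult l d f)
  then obtain q where q: "\<forall>t. f (u + t *\<^sub>C w) = poly q t" by blast
  interpret l: Vector_Spaces.linear scaleC "(*)" l by (rule mult)
  show ?case
    by (rule exI[of _ "[:l u, l w:] * q"]) (simp add: q l.add l.scale distrib_right)
qed

typedef (overloaded) 'a polyfun = "{f :: 'a::complex_vector \<Rightarrow> complex. \<exists>d. polynomial_upto d f}"
  morphisms eval_polyfun Abs_polyfun
  by (auto intro: polynomial_upto.const)

setup_lifting type_definition_polyfun

instantiation polyfun :: (complex_vector) comm_ring_1
begin

lift_definition zero_polyfun :: "'a polyfun" is "\<lambda>_. 0"
  by (auto intro: polynomial_upto.const)

lift_definition one_polyfun :: "'a polyfun" is "\<lambda>_. 1"
  by (auto intro: polynomial_upto.const)

lift_definition plus_polyfun :: "'a polyfun \<Rightarrow> 'a polyfun \<Rightarrow> 'a polyfun" is "\<lambda>f g v. f v + g v"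
  by (blast intro: polynomial_upto_add)

lift_definition uminus_polyfun :: "'a polyfun \<Rightarrow> 'a polyfun" is "\<lambda>f v. - f v"
  using polynomial_upto_scale[of _ _ "-1"] by auto

lift_definition minus_polyfun :: "'a polyfun \<Rightarrow> 'a polyfun \<Rightarrow> 'a polyfun" is "\<lambda>f g v. f v - g v"
proof -
  fix f g :: "'a \<Rightarrow> complex"
  assume "\<exists>d. polynomial_upto d f" "\<exists>d. polynomial_upto d g"
  then obtain d e where "polynomial_upto d f" "polynomial_upto e (\<lambda>v. - 1 * g v)"
    using polynomial_upto_scale by blast
  then have "polynomial_upto (max d e) (\<lambda>v. f v + - 1 * g v)"
    by (rule polynomial_upto_add)
  then show "\<exists>d. polynomial_upto d (\<lambda>v. f v - g v)" by auto
qed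

lift_definition times_polyfun :: "'a polyfun \<Rightarrow> 'a polyfun \<Rightarrow> 'a polyfun" is "\<lambda>f g v. f v * g v"
  by (blast intro: polynomial_upto_mult)

instance
  by standard (transfer; simp add: algebra_simps fun_eq_iff)+

end

instance polyfun :: (complex_vector) idom
proof
  fix f g :: "'a polyfun"
  assume "f \<noteq> 0" "g \<noteq> 0"
  then show "f * g \<noteq> 0"
  proof transfer
    fix f g :: "'a \<Rightarrow> complex"
    assume "\<exists>d. polynomial_upto d f" "\<exists>d. polynomial_upto d g"
      and "f \<noteq> (\<lambda>_. 0)" "g \<noteq> (\<lambda>_. 0)"
    then obtain d e u w where *: "polynomial_upto d f" "polynomial_upto e g" "f u \<noteq> 0" "g w \<noteq> 0"
      by blast
    from *(1,2) obtain q r where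
      q: "\<And>t. f (u + t *\<^sub>C (w - u)) = poly q t" and r: "\<And>t. g (u + t *\<^sub>C (w - u)) = poly r t"
      using polynomial_upto_line by metis
    have "q \<noteq> 0" "r \<noteq> 0" using q[of 0] r[of 1] *(3,4) by auto
    then have "q * r \<noteq> 0" by simp
    then obtain t where "poly (q * r) t \<noteq> 0" using poly_all_0_iff_0 by blast
    then show "(\<lambda>v. f v * g v) \<noteq> (\<lambda>_. 0)" by (metis q r poly_mult)
  qed
qed

lift_definition const_polyfun :: "complex \<Rightarrow> 'a::complex_vector polyfun" is "\<lambda>c _. c"
  by (auto intro: polynomial_upto.const)

type_synonym 'a ratfun = "'a polyfun fract"

abbreviation ratfun_of :: "'a::complex_vector polyfun \<Rightarrow> 'a ratfun" where
  "ratfun_of f \<equiv> Fract f 1"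

locale complex_representation = group_action G UNIV \<rho>
  for G and \<rho> :: "'g \<Rightarrow> 'v::complex_vector \<Rightarrow> 'v" +
  assumes linear: "g \<in> carrier G \<Longrightarrow> clinear (\<rho> g)"

definition character :: "('g \<Rightarrow> 'v::complex_vector \<Rightarrow> 'v) \<Rightarrow> 'g \<Rightarrow> complex" where
  "character \<rho> g = ctrace (\<rho> g)"

definition poly_act ::
    "('g, 'm) monoid_scheme \<Rightarrow> ('g \<Rightarrow> 'v::complex_vector \<Rightarrow> 'v) \<Rightarrow> 'g \<Rightarrow> 'v polyfun \<Rightarrow> 'v polyfun" where
  "poly_act G \<rho> g f = Abs_polyfun (\<lambda>v. eval_polyfun f (\<rho> (inv\<^bsub>G\<^esub> g) v))"

text \<open>The action extended to fractions by \<open>g (a / b) = g a / g b\<close>; see \<open>rat_act_Fract\<close> below.\<close>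

definition rat_act ::
    "('g, 'm) monoid_scheme \<Rightarrow> ('g \<Rightarrow> 'v::complex_vector \<Rightarrow> 'v) \<Rightarrow> 'g \<Rightarrow> 'v ratfun \<Rightarrow> 'v ratfun" where
  "rat_act G \<rho> g q =
    (THE r. \<exists>a b. b \<noteq> 0 \<and> q = Fract a b \<and> r = Fract (poly_act G \<rho> g a) (poly_act G \<rho> g b))"

definition invariant_polys_upto ::
    "('g, 'm) monoid_scheme \<Rightarrow> ('g \<Rightarrow> 'v::complex_vector \<Rightarrow> 'v) \<Rightarrow> nat \<Rightarrow> 'v polyfun set" where
  "invariant_polys_upto G \<rho> d =
    {f. (\<forall>g\<in>carrier G. poly_act G \<rho> g f = f) \<and> polynomial_upto d (eval_polyfun f)}"

definition invariant_ratfuns ::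
    "('g, 'm) monoid_scheme \<Rightarrow> ('g \<Rightarrow> 'v::complex_vector \<Rightarrow> 'v) \<Rightarrow> 'v ratfun set" where
  "invariant_ratfuns G \<rho> = {q. \<forall>g\<in>carrier G. rat_act G \<rho> g q = q}"

definition complex_adjoin :: "'v::complex_vector ratfun set \<Rightarrow> 'v ratfun set" where
  "complex_adjoin S =
    generate_field ring_of_type_algebra (range (\<lambda>c. ratfun_of (const_polyfun c)) \<union> S)"

text \<open>For a finite group and a finite-dimensional space some \<open>d\<close> has the property
  (Noether's bound), so the minimum exists.\<close>

definition field_noether_number ::
    "('g, 'm) monoid_scheme \<Rightarrow> ('g \<Rightarrow> 'v::complex_vector \<Rightarrow> 'v) \<Rightarrow> nat" where
  "field_noether_number G \<rho> =
    (LEAST d. complex_adjoin (ratfun_of ` invariant_polys_upto G \<rho> d) = invariant_ratfuns G \<rho>)"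

definition rat_adjoin :: "complex set \<Rightarrow> complex set" where
  "rat_adjoin S = generate_field ring_of_type_algebra (\<rat> \<union> S)"

text \<open>The degree over the rationals of a subfield of the complex numbers; as \<open>dim\<close> is a natural
  number, it is meaningful for finite extensions only.\<close>

definition rat_degree :: "complex set \<Rightarrow> nat" where
  "rat_degree K = vector_space.dim (\<lambda>(q::rat) (z::complex). of_rat q * z) K"

lemma ctrace_eq:
  fixes T :: "'a::complex_vector \<Rightarrow> 'a"
  assumes T: "clinear T" and B: "finite B" "cvec.independent B" "cvec.span B = UNIV"
  shows "ctrace T = (\<Sum>b\<in>B. cvec.representation B (T b) b)"
proof -
  define C :: "'a set" where "C = cvec.extend_basis {}"
  have C: "cvec.independent C" "cvec.span C = UNIV"
    using cvec.independent_extend_basis[of "{}"] cvec.span_extend_basis[of "{}"]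
    by (auto simp: C_def cvec.independent_empty)
  have finC: "finite C"
    using cvec.independent_span_bound[OF B(1) C(1)] B(3) by auto
  interpret T: Vector_Spaces.linear scaleC scaleC T by (rule T)
  let ?rB = "cvec.representation B" and ?rC = "cvec.representation C"
  have expand: "(\<Sum>x\<in>S. cvec.representation S v x *\<^sub>C x) = v"
    if "finite S" "cvec.independent S" "cvec.span S = UNIV" for S and v :: 'a
    using that by (intro cvec.sum_representation_eq) auto
  have r_sum: "cvec.representation S (\<Sum>y\<in>I. k y *\<^sub>C h y) x
      = (\<Sum>y\<in>I. k y * cvec.representation S (h y) x)"
    if "cvec.independent S" "cvec.span S = UNIV"
    for S I :: "'a set" and k and h :: "'a \<Rightarrow> 'a" and x
    using that by (simp add: cvec.representation_sum cvec.representation_scale)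
  have "ctrace T = (\<Sum>c\<in>C. ?rC (T c) c)"
    by (simp add: ctrace_def C_def Let_def)
  also have "\<dots> = (\<Sum>c\<in>C. \<Sum>b\<in>B. ?rB c b * ?rC (T b) c)"
  proof (rule sum.cong[OF refl])
    fix c assume "c \<in> C"
    have "T c = T (\<Sum>b\<in>B. ?rB c b *\<^sub>C b)" by (simp add: expand[OF B])
    also have "\<dots> = (\<Sum>b\<in>B. ?rB c b *\<^sub>C T b)" by (simp add: T.sum T.scale)
    finally show "?rC (T c) c = (\<Sum>b\<in>B. ?rB c b * ?rC (T b) c)" by (simp add: r_sum[OF C])
  qed
  also have "\<dots> = (\<Sum>b\<in>B. \<Sum>c\<in>C. ?rC (T b) c * ?rB c b)"
    by (subst sum.swap) (simp add: mult.commute)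
  also have "\<dots> = (\<Sum>b\<in>B. ?rB (T b) b)"
  proof (rule sum.cong[OF refl])
    fix b assume "b \<in> B"
    have "?rB (T b) b = ?rB (\<Sum>c\<in>C. ?rC (T b) c *\<^sub>C c) b" by (simp add: expand[OF finC C])
    also have "\<dots> = (\<Sum>c\<in>C. ?rC (T b) c * ?rB c b)"
      using r_sum[OF B(2,3), of _ "\<lambda>c. c"] by simp
    finally show "(\<Sum>c\<in>C. ?rC (T b) c * ?rB c b) = ?rB (T b) b" ..
  qed
  finally show ?thesis .
qed

context complex_representation
begin

lemma eval_poly_act:
  assumes "g \<in> carrier G"
  shows "eval_polyfun (poly_act G \<rho> g f) v = eval_polyfun f (\<rho> (inv\<^bsub>G\<^esub> g) v)"
proof -
  have "inv\<^bsub>G\<^esub> g \<in> carrier G"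
    using assms group_hom by (simp add: group_hom_def group.inv_closed)
  then have "\<exists>d. polynomial_upto d (\<lambda>v. eval_polyfun f (\<rho> (inv\<^bsub>G\<^esub> g) v))"
    using eval_polyfun[of f] polynomial_upto_compose[OF linear] by blast
  then show ?thesis by (simp add: poly_act_def Abs_polyfun_inverse)
qed

lemma poly_act_mult:
  "g \<in> carrier G \<Longrightarrow> poly_act G \<rho> g (a * b) = poly_act G \<rho> g a * poly_act G \<rho> g b"
  by (simp add: eval_polyfun_inject[symmetric] fun_eq_iff times_polyfun.rep_eq eval_poly_act)

lemma poly_act_eq_0:
  assumes g: "g \<in> carrier G" and 0: "poly_act G \<rho> g a = 0"
  shows "a = 0"
proof -
  have "inv\<^bsub>G\<^esub> g \<in> carrier G"
    using g group_hom by (simp add: group_hom_def group.inv_closed)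
  then have "surj (\<rho> (inv\<^bsub>G\<^esub> g))"
    using surj_prop by simp
  then have "eval_polyfun a v = 0" for v
    using eval_poly_act[OF g, of a] 0 by (metis surjD zero_polyfun.rep_eq)
  then show ?thesis by (simp add: eval_polyfun_inject[symmetric] fun_eq_iff zero_polyfun.rep_eq)
qed

lemma rat_act_Fract:
  assumes g: "g \<in> carrier G" and b: "b \<noteq> 0"
  shows "rat_act G \<rho> g (Fract a b) = Fract (poly_act G \<rho> g a) (poly_act G \<rho> g b)"
  unfolding rat_act_def
proof (rule the_equality)
  fix r
  assume "\<exists>a' b'. b' \<noteq> 0 \<and> Fract a b = Fract a' b' \<and>
    r = Fract (poly_act G \<rho> g a') (poly_act G \<rho> g b')"
  then obtain a' b' where r: "b' \<noteq> 0" "Fract a b = Fract a' b'"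
    "r = Fract (poly_act G \<rho> g a') (poly_act G \<rho> g b')" by blast
  then have "poly_act G \<rho> g (a * b') = poly_act G \<rho> g (a' * b)"
    using b by (simp add: eq_fract)
  moreover have "poly_act G \<rho> g b \<noteq> 0" "poly_act G \<rho> g b' \<noteq> 0"
    using poly_act_eq_0 g b r by blast+
  ultimately show "r = Fract (poly_act G \<rho> g a) (poly_act G \<rho> g b)"
    using r by (simp add: eq_fract poly_act_mult g)
qed (use b in blast)

end

end

(*
  Diagonalise V, with weights a(b) in Z/p on a basis of coordinates. Invariant rational functions are
  generated by quotients of invariant polynomials, hence by invariant monomials. If every sum of weights
  is also the sum of at most d of the weights a(b), then every invariant monomial is a product of invariant
  monomials of degree at most 2 d + 1 and their inverses.

  Let H be the group of residues that preserve the multiplicities of the weights. The set of weights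
  is stable under H, so the set of sums of at most k weights grows by a whole H-orbit at each step until
  it is everything; it is everything once k |H| >= p - 1 (unless G acts trivially). On the other hand
  the values chi(g^k), 0 < k < p, take at least (p - 1) / |H| different values, all of them conjugate to
  chi(g), so that [Q(chi) : Q] |H| >= p - 1, and d = [Q(chi) : Q] will do.
*)

theory Submission
  imports Defs
begin

section \<open>Roots of unity of prime order\<close>

text \<open>Write zeta for \<open>root_of_unity p\<close>. The degree of Q(chi) only has to be
  bounded below, and no Galois group is built for that. The automorphism taking zeta to zeta^k is
  replaced by the fact that an integer polynomial vanishing at zeta vanishes at zeta^k whenever p
  does not divide k; this rests on Eisenstein's criterion after the shift X -> X + 1. One obstacle
  is that an infinite dimension counts as 0, so that independent elements alone bound nothing:
  Q(chi) has to be enclosed in Q(zeta), which p elements span.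

  Primality enters again among the residues: multiplication by a nonzero residue is injective, so
  the H-orbit of a nonzero residue has |H| elements. The 2 in 2 d + 1 is the price of staying with
  polynomials: a quotient of two monomials of equal weight is invariant but not a polynomial, so
  both are multiplied by a monomial of inverse weight, which may cost another d factors.\<close>

lemma eisenstein_factor:
  fixes f :: "'a::idom poly"
  assumes q: "prime_elem q" and lead: "\<not> q dvd lead_coeff f"
    and low: "\<And>i. i < degree f \<Longrightarrow> q dvd coeff f i"
    and const: "\<not> q ^ 2 dvd coeff f 0"
    and f: "f = A * B"
  shows "degree A = 0 \<or> degree B = 0"
proof -
  \<comment> \<open>The constant term puts \<open>q\<close> into exactly one of the two factors,
    here \<open>P\<close>. If \<open>Q\<close> were not constant, the first coefficient of
    \<open>P\<close> not divisible by \<open>q\<close> would sit at an index below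
    \<open>degree f\<close>, where modulo \<open>q\<close> the coefficient of \<open>P * Q\<close>
    reduces to that coefficient times \<open>coeff Q 0\<close>.\<close>
  have main: "degree Q = 0" if PQ: "f = P * Q" and P0: "q dvd coeff P 0" and Q0: "\<not> q dvd coeff Q 0"
    for P Q :: "'a poly"
  proof (rule ccontr)
    assume Q: "degree Q \<noteq> 0"
    have lP: "\<not> q dvd lead_coeff P"
      using lead dvd_mult2 unfolding PQ lead_coeff_mult by blast
    define i where "i = (LEAST i. \<not> q dvd coeff P i)"
    have i: "\<not> q dvd coeff P i"
      unfolding i_def using lP by (rule LeastI)
    have less: "q dvd coeff P j" if "j < i" for j
      using not_less_Least that unfolding i_def by blast
    have "i \<le> degree P"
      unfolding i_def using lP by (rule Least_le)
    moreover have "P \<noteq> 0" "Q \<noteq> 0" using lead PQ by auto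
    ultimately have "i < degree f" using Q PQ by (simp add: degree_mult_eq)
    then have "q dvd coeff (P * Q) i" using low PQ by simp
    also have "coeff (P * Q) i = (\<Sum>j\<le>i. coeff P j * coeff Q (i - j))"
      by (rule coeff_mult)
    also have "\<dots> = (\<Sum>j<i. coeff P j * coeff Q (i - j)) + coeff P i * coeff Q 0"
      by (simp add: lessThan_Suc_atMost[symmetric])
    finally have "q dvd coeff P i * coeff Q 0"
      using less by (metis (no_types, lifting) dvd_add_right_iff dvd_mult2 dvd_sum lessThan_iff)
    then show False using q i Q0 by (simp add: prime_elem_dvd_mult_iff)
  qed
  show ?thesis
  proof (cases "degree f = 0")
    case True
    then have "degree A + degree B = 0"
      using f lead by (metis degree_mult_eq mult_zero_left mult_zero_right dvd_0_right leading_coeff_0_iff)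
    then show ?thesis by simp
  next
    case False
    then have "q dvd coeff f 0" using low by simp
    then have "q dvd coeff A 0 \<or> q dvd coeff B 0"
      using q by (simp add: f coeff_mult_0 prime_elem_dvd_mult_iff)
    moreover have "\<not> (q dvd coeff A 0 \<and> q dvd coeff B 0)"
      using const by (auto simp: f coeff_mult_0 power2_eq_square intro: mult_dvd_mono)
    ultimately show ?thesis
      using main[of A B] main[of B A] f by (auto simp: mult.commute)
  qed
qed

text \<open>The polynomial \<open>((X + 1) ^ p - 1) / X\<close>, that is, the \<open>p\<close>-th cyclotomic polynomial at \<open>X + 1\<close>,
  for which Eisenstein's criterion applies.\<close>

definition shifted_cyclotomic :: "nat \<Rightarrow> int poly" where
  "shifted_cyclotomic p = (\<Sum>i<p. monom (of_nat (p choose Suc i)) i)"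

lemma coeff_shifted_cyclotomic:
  "coeff (shifted_cyclotomic p) i = (if i < p then of_nat (p choose Suc i) else 0)"
  by (simp add: shifted_cyclotomic_def coeff_sum if_distrib cong: if_cong)

lemma degree_shifted_cyclotomic:
  assumes "p > 0" shows "degree (shifted_cyclotomic p) = p - 1"
proof (rule antisym)
  show "degree (shifted_cyclotomic p) \<le> p - 1"
    by (rule degree_le) (auto simp: coeff_shifted_cyclotomic)
  show "p - 1 \<le> degree (shifted_cyclotomic p)"
    using assms by (intro le_degree) (simp add: coeff_shifted_cyclotomic)
qed

text \<open>Coefficients stay integral, where Eisenstein's criterion applies; denominators of
  rational relations are carried along as explicit integer factors.\<close>

definition int_poly_eval :: "int poly \<Rightarrow> complex \<Rightarrow> complex" where
  "int_poly_eval P = poly (map_poly of_int P)"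

lemma int_poly_eval_simps [simp]:
  "int_poly_eval 0 x = 0" "int_poly_eval 1 x = 1"
  "int_poly_eval (pCons a P) x = of_int a + x * int_poly_eval P x"
  "int_poly_eval (monom a n) x = of_int a * x ^ n"
  by (simp_all add: int_poly_eval_def map_poly_pCons map_poly_monom poly_monom)

lemma int_poly_eval_add [simp]: "int_poly_eval (P + Q) x = int_poly_eval P x + int_poly_eval Q x"
  by (induction P Q rule: poly_induct2) (simp_all add: algebra_simps)

lemma int_poly_eval_smult [simp]: "int_poly_eval (smult a P) x = of_int a * int_poly_eval P x"
  by (induction P) (simp_all add: algebra_simps)

lemma int_poly_eval_uminus [simp]: "int_poly_eval (- P) x = - int_poly_eval P x"
  using int_poly_eval_smult[of "-1" P x] by simp

lemma int_poly_eval_mult [simp]: "int_poly_eval (P * Q) x = int_poly_eval P x * int_poly_eval Q x"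
  by (induction P) (simp_all add: algebra_simps)

lemma int_poly_eval_sum: "int_poly_eval (\<Sum>i\<in>I. P i) x = (\<Sum>i\<in>I. int_poly_eval (P i) x)"
  by (induction I rule: infinite_finite_induct) simp_all

lemma int_poly_eval_pcompose [simp]:
  "int_poly_eval (pcompose P Q) x = int_poly_eval P (int_poly_eval Q x)"
  by (induction P) (simp_all add: pcompose_pCons)

lemma int_poly_eval_altdef: "int_poly_eval P x = (\<Sum>i\<le>degree P. of_int (coeff P i) * x ^ i)"
  by (simp add: int_poly_eval_def poly_altdef degree_map_poly coeff_map_poly)

lemma int_poly_eval_shifted_cyclotomic:
  "x * int_poly_eval (shifted_cyclotomic p) x = (x + 1) ^ p - 1"
proof -
  have "x * int_poly_eval (shifted_cyclotomic p) x = (\<Sum>i<p. of_nat (p choose Suc i) * x ^ Suc i)"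
    by (simp add: shifted_cyclotomic_def int_poly_eval_sum sum_distrib_left ac_simps)
  also have "\<dots> = (\<Sum>i\<le>p. of_nat (p choose i) * x ^ i) - 1"
    by (simp add: sum.lessThan_Suc_shift flip: lessThan_Suc_atMost del: sum.lessThan_Suc)
  also have "\<dots> = (x + 1) ^ p - 1"
    by (simp add: binomial_ring)
  finally show ?thesis .
qed

text \<open>Eisenstein at \<open>p\<close>: below the top the coefficients are binomials
  \<open>p choose i\<close> with 0 < i < p, and the constant one is \<open>p\<close> itself.\<close>

lemma irreducible_shifted_cyclotomic:
  assumes p: "prime p" shows "irreducible (shifted_cyclotomic p)"
proof (rule irreducibleI)
  let ?E = "shifted_cyclotomic p"
  have p2: "p \<ge> 2" using p by (rule prime_ge_2_nat)
  have deg: "degree ?E = p - 1" using p2 by (simp add: degree_shifted_cyclotomic)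
  have lead: "lead_coeff ?E = 1"
    using p2 by (simp add: deg coeff_shifted_cyclotomic)
  show "?E \<noteq> 0" using lead by auto
  show "\<not> ?E dvd 1" using deg p2 by (auto simp: is_unit_poly_iff)
  fix A B assume AB: "?E = A * B"
  have "degree A = 0 \<or> degree B = 0"
  proof (rule eisenstein_factor[where q = "int p", OF _ _ _ _ AB])
    show pp: "prime_elem (int p)" using p by simp
    show "\<not> int p dvd lead_coeff ?E" using p2 by (simp add: lead)
    show "int p dvd coeff ?E i" if "i < degree ?E" for i
    proof -
      have "p dvd p choose Suc i"
        using that deg p by (intro dvd_choose_prime) auto
      then show ?thesis using that deg by (simp add: coeff_shifted_cyclotomic)
    qed
    have "\<not> p * p dvd p" using p2 by (auto dest: dvd_imp_le)
    then show "\<not> (int p)\<^sup>2 dvd coeff ?E 0"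
      using p2 by (simp add: coeff_shifted_cyclotomic power2_eq_square flip: of_nat_mult)
  qed
  \<comment> \<open>So far one factor is merely constant; since the product is monic, that constant
    is a unit.\<close>
  moreover have "lead_coeff A * lead_coeff B = 1" using lead AB by (simp add: lead_coeff_mult)
  then have "lead_coeff A dvd 1" "lead_coeff B dvd 1" by (metis dvdI mult.commute)+
  ultimately show "A dvd 1 \<or> B dvd 1"
    by (auto simp: is_unit_poly_iff elim!: degree_eq_zeroE)
qed

text \<open>A nonzero element of least degree in the ideal of \<open>E\<close> and \<open>F\<close> divides both up to constants.\<close>

lemma prime_elem_poly_bezout:
  fixes E F :: "'a::idom poly"
  assumes E: "prime_elem E" "degree E \<noteq> 0" and ndvd: "\<not> E dvd F"
  obtains U V c where "c \<noteq> 0" "U * F + V * E = [:c:]"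
proof -
  define I where "I = {U * F + V * E |U V. True}"
  have I_comb: "A * P + B * R \<in> I" if "P \<in> I" "R \<in> I" for A B P R
  proof -
    from that obtain U V U' V' where "P = U * F + V * E" "R = U' * F + V' * E"
      by (auto simp: I_def)
    then have "A * P + B * R = (A * U + B * U') * F + (A * V + B * V') * E"
      by (simp add: algebra_simps)
    then show ?thesis unfolding I_def by blast
  qed
  have EI: "E \<in> I" and FI: "F \<in> I"
    using I_def by (force intro: exI[of _ 0] exI[of _ 1])+
  obtain D where D: "D \<in> I" "D \<noteq> 0" and min: "\<And>P. P \<in> I \<Longrightarrow> P \<noteq> 0 \<Longrightarrow> degree D \<le> degree P"
    using ex_has_least_nat[of "\<lambda>P. P \<in> I \<and> P \<noteq> 0" E degree] EI E by auto
  \<comment> \<open>Without a field of coefficients, division by \<open>D\<close> works only up to a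
    constant \<open>a\<close>; minimality of \<open>degree D\<close> kills the
    pseudo-remainder.\<close>
  have divides: "\<exists>a Q. a \<noteq> 0 \<and> smult a P = D * Q" if "P \<in> I" for P
  proof -
    obtain a Q where aQ: "a \<noteq> 0" "smult a P = D * Q + pseudo_mod P D"
      using pseudo_mod(1)[OF D(2)] by blast
    have "pseudo_mod P D = [:a:] * P + (- Q) * D" using aQ(2) by (simp add: algebra_simps)
    then have "pseudo_mod P D \<in> I" using I_comb that D(1) by metis
    then have "pseudo_mod P D = 0"
      using pseudo_mod(2)[OF D(2), of P] min by (meson not_less)
    then show ?thesis using aQ by auto
  qed
  have E_const: "\<not> E dvd [:a:]" if "a \<noteq> 0" for a
    using that E by (auto dest: dvd_imp_degree_le)
  obtain a Q where aQ: "a \<noteq> 0" "smult a E = D * Q" using divides EI by blast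
  then have "E dvd D * Q" by (metis dvd_refl dvd_smult)
  then have "E dvd D \<or> E dvd Q" using E by (simp add: prime_elem_dvd_mult_iff)
  \<comment> \<open>If \<open>E\<close> divided \<open>D\<close>, it would divide a nonzero constant
    multiple of \<open>F\<close>. Hence \<open>E\<close> divides the cofactor \<open>Q\<close> and
    cancels, which leaves \<open>D\<close> as a divisor of a constant.\<close>
  moreover have "\<not> E dvd D"
  proof
    assume "E dvd D"
    moreover obtain b Q' where b: "b \<noteq> 0" "smult b F = D * Q'" using divides FI by blast
    ultimately have "E dvd [:b:] * F" by simp
    then show False using E ndvd E_const[OF b(1)] by (simp only: prime_elem_dvd_mult_iff) simp
  qed
  ultimately obtain Q' where "Q = E * Q'" by blast
  with aQ have "E * [:a:] = E * (D * Q')" by (simp add: ac_simps)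
  then have "D * Q' = [:a:]" using E by (metis degree_0 mult_left_cancel)
  then have "degree D = 0"
    using aQ(1) D(2) by (metis add_is_0 degree_mult_eq degree_pCons_0 mult_zero_right pCons_eq_0_iff)
  then obtain c where "D = [:c:]" by (rule degree_eq_zeroE)
  moreover obtain U V where "D = U * F + V * E" using D(1) by (auto simp: I_def)
  ultimately show thesis using that[of c U V] D(2) by auto
qed

abbreviation root_of_unity :: "nat \<Rightarrow> complex" where
  "root_of_unity p \<equiv> cis (2 * pi / p)"

lemma root_of_unity_power: "root_of_unity p ^ k = cis (2 * pi * k / p)"
  by (simp add: DeMoivre ac_simps)

lemma root_of_unity_power_mod:
  assumes "p > 0" shows "root_of_unity p ^ (k mod p) = root_of_unity p ^ k"
proof -
  have "root_of_unity p ^ p = 1" using assms by (simp add: root_of_unity_power)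
  then have "root_of_unity p ^ (p * (k div p) + k mod p) = root_of_unity p ^ (k mod p)"
    by (simp only: power_add power_mult) simp
  then show ?thesis by simp
qed

lemma root_of_unity_power_eq_iff:
  assumes "p > 0" shows "root_of_unity p ^ k = root_of_unity p ^ l \<longleftrightarrow> k mod p = l mod p"
proof -
  have "inj_on (\<lambda>k. root_of_unity p ^ k) {..<p}"
    using bij_betw_roots_unity[OF assms] unfolding root_of_unity_power bij_betw_def by blast
  then have "root_of_unity p ^ (k mod p) = root_of_unity p ^ (l mod p) \<longleftrightarrow> k mod p = l mod p"
    using assms by (intro inj_on_eq_iff) auto
  then show ?thesis by (simp add: root_of_unity_power_mod assms)
qed

lemma root_of_unity_power_eq_1_iff:
  assumes "p > 0" shows "root_of_unity p ^ k = 1 \<longleftrightarrow> p dvd k"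
  using root_of_unity_power_eq_iff[OF assms, of k 0] by (simp add: mod_eq_0_iff_dvd)

lemma int_poly_eval_shifted_cyclotomic_root:
  assumes "p > 0" "\<not> p dvd k"
  shows "int_poly_eval (shifted_cyclotomic p) (root_of_unity p ^ k - 1) = 0"
proof -
  have "(root_of_unity p ^ k) ^ p = 1"
    using assms root_of_unity_power_eq_1_iff[of p "k * p"] by (simp add: power_mult)
  then show ?thesis
    using int_poly_eval_shifted_cyclotomic[of "root_of_unity p ^ k - 1" p] assms
    by (simp add: root_of_unity_power_eq_1_iff)
qed

text \<open>The shifted cyclotomic polynomial is prime. Either it divides the shifted
  \<open>F\<close>, which then inherits its roots zeta^k - 1, or a combination of the two is a
  nonzero constant, and evaluation at zeta - 1 inverts the value of \<open>F\<close> up to an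
  integer. The first case provides conjugation, the second one inverses in Q(zeta).\<close>

lemma root_of_unity_poly_cases:
  assumes p: "prime p"
  obtains (conjugates) "\<And>k. \<not> p dvd k \<Longrightarrow> int_poly_eval F (root_of_unity p ^ k) = 0"
  | (invertible) U c where "c \<noteq> 0"
      "int_poly_eval U (root_of_unity p) * int_poly_eval F (root_of_unity p) = of_int c"
proof -
  let ?E = "shifted_cyclotomic p" and ?F = "pcompose F [:1, 1:]"
  have p2: "p \<ge> 2" using p by (rule prime_ge_2_nat)
  have root: "int_poly_eval ?E (root_of_unity p ^ k - 1) = 0" if "\<not> p dvd k" for k
    using p2 that by (intro int_poly_eval_shifted_cyclotomic_root) auto
  have shift: "int_poly_eval ?F (x - 1) = int_poly_eval F x" for x by simp
  show thesis
  proof (cases "?E dvd ?F")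
    case True
    then obtain Q where "?F = ?E * Q" by blast
    then have "int_poly_eval F (root_of_unity p ^ k) = 0" if "\<not> p dvd k" for k
      using root[OF that] shift[of "root_of_unity p ^ k"] by simp
    then show ?thesis by (rule conjugates)
  next
    case False
    have "prime_elem ?E"
      using irreducible_shifted_cyclotomic[OF p] by (rule irreducible_imp_prime_poly)
    moreover have "degree ?E \<noteq> 0" using p2 by (simp add: degree_shifted_cyclotomic)
    ultimately obtain U V c where c: "c \<noteq> 0" "U * ?F + V * ?E = [:c:]"
      using prime_elem_poly_bezout False by metis
    have "int_poly_eval (U * ?F + V * ?E) (root_of_unity p - 1) = of_int c"
      unfolding c by simp
    moreover have "int_poly_eval ?E (root_of_unity p - 1) = 0"
      using root[of 1] p2 by simp
    ultimately have "int_poly_eval (pcompose U [:-1, 1:]) (root_of_unity p)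
        * int_poly_eval F (root_of_unity p) = of_int c"
      using shift[of "root_of_unity p"] by simp
    then show ?thesis using c(1) invertible by blast
  qed
qed

corollary root_of_unity_conjugate:
  assumes "prime p" "int_poly_eval F (root_of_unity p) = 0" "\<not> p dvd k"
  shows "int_poly_eval F (root_of_unity p ^ k) = 0"
  using root_of_unity_poly_cases[OF assms(1), of F] assms(2,3) by (metis mult_zero_right of_int_eq_0_iff)

corollary root_of_unity_poly_inverse:
  assumes "prime p" "int_poly_eval F (root_of_unity p) \<noteq> 0"
  obtains U c where "c \<noteq> 0"
    "int_poly_eval U (root_of_unity p) * int_poly_eval F (root_of_unity p) = of_int c"
proof (rule root_of_unity_poly_cases[OF assms(1), of F])
  assume "\<And>k. \<not> p dvd k \<Longrightarrow> int_poly_eval F (root_of_unity p ^ k) = 0"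
  from this[of 1] show thesis using assms by (auto simp: prime_nat_iff)
qed

section \<open>Sums of residues modulo a prime\<close>

text \<open>The \<open>k\<close>-fold sumset of \<open>A\<close> together with 0, modulo
  \<open>p\<close>; multisets allow repeated summands.\<close>

definition residue_sums :: "nat \<Rightarrow> nat set \<Rightarrow> nat \<Rightarrow> nat set" where
  "residue_sums p A k = {sum_mset M mod p |M. set_mset M \<subseteq> A \<and> size M \<le> k}"

lemma inj_on_mult_mod_prime:
  fixes p r :: nat
  assumes p: "prime p" and r: "\<not> p dvd r"
  shows "inj_on (\<lambda>h. h * r mod p) {..<p}"
proof (rule inj_onI)
  fix x y assume xy: "x \<in> {..<p}" "y \<in> {..<p}" and "x * r mod p = y * r mod p"
  then have "int (x * r) mod int p = int (y * r) mod int p" by (simp only: flip: of_nat_mod)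
  then have "int p dvd (int x - int y) * int r" by (simp add: mod_eq_dvd_iff left_diff_distrib)
  then have "int p dvd int x - int y"
    using p r by (simp add: prime_dvd_mult_iff)
  then have "int x mod int p = int y mod int p" by (simp add: mod_eq_dvd_iff)
  then show "x = y" using xy by simp
qed

text \<open>If the sums of at most \<open>k\<close> elements are not closed under adding \<open>c\<close>, the new sums include a whole
  \<open>H\<close>-orbit of a nonzero residue.\<close>

lemma residue_sums_step:
  assumes p: "prime p" and H: "H \<subseteq> {0<..<p}"
    and inv: "\<And>h a. h \<in> H \<Longrightarrow> a \<in> A \<Longrightarrow> h * a mod p \<in> A"
    and c: "c \<in> A" "\<not> p dvd c"
  shows "min p (card (residue_sums p A k) + card H) \<le> card (residue_sums p A (Suc k))"
proof -
  let ?S = "residue_sums p A"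
  have p0: "p > 0" using p by (rule prime_gt_0_nat)
  have sub: "?S j \<subseteq> {..<p}" for j using p0 by (auto simp: residue_sums_def)
  then have fin: "finite (?S j)" for j by (rule finite_subset) simp
  have mono: "?S k \<subseteq> ?S (Suc k)" by (fastforce simp: residue_sums_def)
  have zero: "0 \<in> ?S k" unfolding residue_sums_def by (rule CollectI, rule exI[of _ "{#}"]) simp
  \<comment> \<open>Multiplying every summand by \<open>h\<close> stays inside \<open>A\<close>, so
    stability under \<open>H\<close> passes from \<open>A\<close> to its sums.\<close>
  have scale: "h * r mod p \<in> ?S j" if h: "h \<in> H" and r: "r \<in> ?S j" for h r j
  proof -
    obtain M where M: "r = sum_mset M mod p" "set_mset M \<subseteq> A" "size M \<le> j"
      using r by (auto simp: residue_sums_def)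
    let ?M = "image_mset (\<lambda>a. h * a mod p) M"
    have "sum_mset ?M mod p = h * sum_mset M mod p"
    proof (induction M)
      case (add x M)
      from mod_add_cong[OF refl add, of "h * x"] show ?case by (simp add: distrib_left mod_add_left_eq)
    qed simp
    then have "h * r mod p = sum_mset ?M mod p" by (simp add: M(1) mod_simps)
    moreover have "set_mset ?M \<subseteq> A" "size ?M \<le> j" using M inv h by auto
    ultimately show ?thesis unfolding residue_sums_def by blast
  qed
  show ?thesis
  proof (cases "?S (Suc k) \<subseteq> ?S k")
    case True
    \<comment> \<open>If nothing new appears, the sums are closed under adding \<open>c\<close>, so
      they contain all multiples of \<open>c\<close>, which are all residues because
      \<open>p\<close> is prime.\<close>
    have add_c: "(r + c) mod p \<in> ?S k" if r: "r \<in> ?S k" for r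
    proof -
      obtain M where M: "r = sum_mset M mod p" "set_mset M \<subseteq> A" "size M \<le> k"
        using r by (auto simp: residue_sums_def)
      have "(r + c) mod p = sum_mset (add_mset c M) mod p" by (simp add: M(1) mod_simps add.commute)
      moreover have "set_mset (add_mset c M) \<subseteq> A" "size (add_mset c M) \<le> Suc k" using M c by auto
      ultimately have "(r + c) mod p \<in> ?S (Suc k)" unfolding residue_sums_def by blast
      then show ?thesis using True by blast
    qed
    have "n * c mod p \<in> ?S k" for n
    proof (induction n)
      case (Suc n)
      then show ?case using add_c[of "n * c mod p"] by (simp add: mod_simps add.commute)
    qed (simp add: zero)
    then have "(\<lambda>n. n * c mod p) ` {..<p} \<subseteq> ?S k" by blast
    then have "card ((\<lambda>n. n * c mod p) ` {..<p}) \<le> card (?S k)" by (rule card_mono[OF fin])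
    then have "p \<le> card (?S k)" by (simp add: card_image inj_on_mult_mod_prime[OF p c(2)])
    also have "\<dots> \<le> card (?S (Suc k))" by (rule card_mono[OF fin mono])
    finally show ?thesis by simp
  next
    case False
    then obtain r where r: "r \<in> ?S (Suc k)" "r \<notin> ?S k" by blast
    then have "0 < r" "r < p" using zero sub by (auto intro: gr0I)
    then have pr: "\<not> p dvd r" by (simp add: nat_dvd_not_less)
    let ?T = "(\<lambda>h. h * r mod p) ` H"
    \<comment> \<open>Multiplication by \<open>h\<close> maps the finite set \<open>?S k\<close>
      injectively into itself, hence onto itself; a product \<open>h * r\<close> in
      \<open>?S k\<close> would force \<open>r\<close> into it as well.\<close>
    have "h * r mod p \<notin> ?S k" if h: "h \<in> H" for h
    proof
      assume *: "h * r mod p \<in> ?S k"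
      have "\<not> p dvd h" using h H by (auto simp: nat_dvd_not_less)
      then have inj: "inj_on (\<lambda>s. h * s mod p) {..<p}"
        using inj_on_mult_mod_prime[OF p] by (simp add: mult.commute[of h])
      have "(\<lambda>s. h * s mod p) ` ?S k = ?S k"
        using scale[OF h] inj_on_subset[OF inj sub] by (intro endo_inj_surj[OF fin]) blast+
      then obtain s where "s \<in> ?S k" "h * r mod p = h * s mod p" using * by blast
      then show False using inj_onD[OF inj, of r s] r sub by blast
    qed
    then have "?T \<inter> ?S k = {}" by blast
    moreover have "?T \<union> ?S k \<subseteq> ?S (Suc k)" using scale r(1) mono by blast
    moreover have "card ?T = card H"
      using H by (intro card_image inj_on_subset[OF inj_on_mult_mod_prime[OF p pr]]) auto
    moreover have "finite ?T" using H by (meson finite_greaterThanLessThan finite_imageI finite_subset)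
    ultimately have "card H + card (?S k) \<le> card (?S (Suc k))"
      using card_mono[OF fin, of "?T \<union> ?S k" "Suc k"] card_Un_disjoint[of ?T "?S k"] fin by simp
    then show ?thesis by simp
  qed
qed

text \<open>The growth starts from the single sum 0, so \<open>k\<close> steps give at least
  \<open>min p (1 + k * card H)\<close> sums; this 1 is why \<open>p - 1\<close> is the
  threshold.\<close>

lemma residue_sums_eq:
  assumes "prime p" "H \<subseteq> {0<..<p}" "\<And>h a. h \<in> H \<Longrightarrow> a \<in> A \<Longrightarrow> h * a mod p \<in> A"
    and "c \<in> A" "\<not> p dvd c" and d: "p - 1 \<le> d * card H"
  shows "residue_sums p A d = {..<p}"
proof -
  have p0: "p > 0" using \<open>prime p\<close> by (rule prime_gt_0_nat)
  have "min p (1 + k * card H) \<le> card (residue_sums p A k)" for k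
  proof (induction k)
    case 0
    have "residue_sums p A 0 = {0}" by (auto simp: residue_sums_def)
    then show ?case by simp
  next
    case (Suc k)
    then show ?case using residue_sums_step[OF assms(1-5), of k] by simp
  qed
  from this[of d] have "p \<le> card (residue_sums p A d)" using d p0 by simp
  moreover have "residue_sums p A d \<subseteq> {..<p}" using p0 by (auto simp: residue_sums_def)
  ultimately show ?thesis by (simp add: card_seteq)
qed

section \<open>Invariants of a diagonal representation\<close>

lemma ring_of_type_algebra_simps [simp]:
  "carrier ring_of_type_algebra = UNIV"
  "monoid.mult ring_of_type_algebra = (*)" "one ring_of_type_algebra = 1"
  "add ring_of_type_algebra = (+)" "zero ring_of_type_algebra = 0"
  by (simp_all add: ring_of_type_algebra_def)

lemma a_inv_ring_of_type_algebra [simp]: "a_inv ring_of_type_algebra (x::'a::comm_ring_1) = - x"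
proof -
  interpret R: cring "ring_of_type_algebra :: 'a ring" by (rule cring_from_type_algebra)
  show ?thesis by (rule R.minus_equality) simp_all
qed

lemma m_inv_ring_of_type_algebra [simp]:
  assumes "x \<noteq> 0" shows "m_inv ring_of_type_algebra (x::'a::field) = inverse x"
proof -
  interpret R: cring "ring_of_type_algebra :: 'a ring" by (rule cring_from_type_algebra)
  show ?thesis using assms by (intro R.comm_inv_char) simp_all
qed

abbreviation field_generated :: "'a::field set \<Rightarrow> 'a set" where
  "field_generated \<equiv> generate_field ring_of_type_algebra"

lemma field_generated_incl: "x \<in> S \<Longrightarrow> x \<in> field_generated S"
  by (rule generate_field.incl)

lemma field_generated_1: "1 \<in> field_generated S"
  using generate_field.one[of ring_of_type_algebra S] by simp

lemma field_generated_add: "x \<in> field_generated S \<Longrightarrow> y \<in> field_generated S \<Longrightarrow> x + y \<in> field_generated S"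
  using generate_field.eng_add[of x ring_of_type_algebra S y] by simp

lemma field_generated_uminus: "x \<in> field_generated S \<Longrightarrow> - x \<in> field_generated S"
  using generate_field.a_inv[of x ring_of_type_algebra S] by simp

lemma field_generated_0: "0 \<in> field_generated S"
  using field_generated_add[OF field_generated_1 field_generated_uminus[OF field_generated_1]] by simp

lemma field_generated_mult: "x \<in> field_generated S \<Longrightarrow> y \<in> field_generated S \<Longrightarrow> x * y \<in> field_generated S"
  using generate_field.eng_mult[of x ring_of_type_algebra S y] by simp

lemma field_generated_inverse: "x \<in> field_generated S \<Longrightarrow> inverse x \<in> field_generated S"
  using generate_field.m_inv[of x ring_of_type_algebra S] field_generated_0 by (cases "x = 0") simp_all

lemma field_generated_divide: "x \<in> field_generated S \<Longrightarrow> y \<in> field_generated S \<Longrightarrow> x / y \<in> field_generated S"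
  by (simp add: divide_inverse field_generated_mult field_generated_inverse)

lemma field_generated_power: "x \<in> field_generated S \<Longrightarrow> x ^ n \<in> field_generated S"
  by (induction n) (auto intro: field_generated_1 field_generated_mult)

lemma field_generated_subset:
  assumes "S \<subseteq> K" "1 \<in> K" "\<And>x. x \<in> K \<Longrightarrow> - x \<in> K" "\<And>x. x \<in> K \<Longrightarrow> x \<noteq> 0 \<Longrightarrow> inverse x \<in> K"
    "\<And>x y. x \<in> K \<Longrightarrow> y \<in> K \<Longrightarrow> x + y \<in> K" "\<And>x y. x \<in> K \<Longrightarrow> y \<in> K \<Longrightarrow> x * y \<in> K"
  shows "field_generated S \<subseteq> K"
proof
  fix x assume "x \<in> field_generated S"
  then show "x \<in> K" by induction (use assms in auto)
qed

lemma eval_polyfun_simps [simp]: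
  "eval_polyfun 0 v = 0" "eval_polyfun 1 v = 1" "eval_polyfun (const_polyfun c) v = c"
  "eval_polyfun (f + g) v = eval_polyfun f v + eval_polyfun g v"
  "eval_polyfun (f * g) v = eval_polyfun f v * eval_polyfun g v"
  "eval_polyfun (- f) v = - eval_polyfun f v"
  by (simp_all add: zero_polyfun.rep_eq one_polyfun.rep_eq const_polyfun.rep_eq plus_polyfun.rep_eq
      times_polyfun.rep_eq uminus_polyfun.rep_eq)

lemma eval_polyfun_sum: "eval_polyfun (sum f I) v = (\<Sum>i\<in>I. eval_polyfun (f i) v)"
  by (induction I rule: infinite_finite_induct) simp_all

lemma eval_polyfun_prod: "eval_polyfun (prod f I) v = (\<Prod>i\<in>I. eval_polyfun (f i) v)"
  by (induction I rule: infinite_finite_induct) simp_all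

lemma polyfun_eqI: "(\<And>v. eval_polyfun f v = eval_polyfun g v) \<Longrightarrow> f = g"
  by (simp add: eval_polyfun_inject[symmetric] fun_eq_iff)

lemma ratfun_of_mult: "ratfun_of (f * g) = ratfun_of f * ratfun_of g"
  by simp

lemma ratfun_of_add: "ratfun_of (f + g) = ratfun_of f + ratfun_of g"
  by simp

lemma ratfun_of_eq_0_iff: "ratfun_of f = 0 \<longleftrightarrow> f = 0"
  by (simp add: Zero_fract_def eq_fract)

section \<open>The group action on polynomial and rational functions\<close>

context complex_representation
begin

sublocale group G
  using group_hom by (simp add: group_hom_def)

lemma action_mult: "g \<in> carrier G \<Longrightarrow> h \<in> carrier G \<Longrightarrow> \<rho> (g \<otimes>\<^bsub>G\<^esub> h) v = \<rho> g (\<rho> h v)"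
  by (rule composition_rule) simp_all

lemma action_one [simp]: "\<rho> \<one>\<^bsub>G\<^esub> v = v"
  using id_eq_one by (metis UNIV_I restrict_apply')

text \<open>Acting by the inverse undoes the inverse built into \<open>poly_act\<close>. Later
  formulas use this form, so that eigenvalues appear uninverted; sums and products over the whole
  group are the same either way.\<close>

lemma eval_poly_act_inv:
  "g \<in> carrier G \<Longrightarrow> eval_polyfun (poly_act G \<rho> (inv\<^bsub>G\<^esub> g) f) v = eval_polyfun f (\<rho> g v)"
  by (simp add: eval_poly_act)

lemma poly_act_add:
  "g \<in> carrier G \<Longrightarrow> poly_act G \<rho> g (a + b) = poly_act G \<rho> g a + poly_act G \<rho> g b"
  by (rule polyfun_eqI) (simp add: eval_poly_act)

lemma poly_act_uminus: "g \<in> carrier G \<Longrightarrow> poly_act G \<rho> g (- a) = - poly_act G \<rho> g a"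
  by (rule polyfun_eqI) (simp add: eval_poly_act)

lemma poly_act_const [simp]: "g \<in> carrier G \<Longrightarrow> poly_act G \<rho> g (const_polyfun c) = const_polyfun c"
  by (rule polyfun_eqI) (simp add: eval_poly_act)

lemma poly_act_1 [simp]: "g \<in> carrier G \<Longrightarrow> poly_act G \<rho> g 1 = 1"
  by (rule polyfun_eqI) (simp add: eval_poly_act)

lemma rat_act_ratfun_of: "g \<in> carrier G \<Longrightarrow> rat_act G \<rho> g (ratfun_of f) = ratfun_of (poly_act G \<rho> g f)"
  by (simp add: rat_act_Fract)

lemma ratfun_of_invariant_iff:
  "ratfun_of f \<in> invariant_ratfuns G \<rho> \<longleftrightarrow> (\<forall>g\<in>carrier G. poly_act G \<rho> g f = f)"
  by (auto simp: invariant_ratfuns_def rat_act_ratfun_of eq_fract)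

lemma
  assumes g: "g \<in> carrier G"
  shows rat_act_add: "rat_act G \<rho> g (q + r) = rat_act G \<rho> g q + rat_act G \<rho> g r"
    and rat_act_mult: "rat_act G \<rho> g (q * r) = rat_act G \<rho> g q * rat_act G \<rho> g r"
    and rat_act_uminus: "rat_act G \<rho> g (- q) = - rat_act G \<rho> g q"
    and rat_act_inverse: "rat_act G \<rho> g (inverse q) = inverse (rat_act G \<rho> g q)"
proof -
  obtain a b where q: "q = Fract a b" "b \<noteq> 0" by (cases q)
  obtain c d where r: "r = Fract c d" "d \<noteq> 0" by (cases r)
  note [simp] = rat_act_Fract[OF g] poly_act_mult[OF g] poly_act_add[OF g] poly_act_uminus[OF g]
  have nz: "x \<noteq> 0 \<Longrightarrow> poly_act G \<rho> g x \<noteq> 0" for x using poly_act_eq_0[OF g] by blast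
  show "rat_act G \<rho> g (q + r) = rat_act G \<rho> g q + rat_act G \<rho> g r"
    "rat_act G \<rho> g (q * r) = rat_act G \<rho> g q * rat_act G \<rho> g r"
    "rat_act G \<rho> g (- q) = - rat_act G \<rho> g q"
    using q r by (simp_all add: nz)
  show "rat_act G \<rho> g (inverse q) = inverse (rat_act G \<rho> g q)"
  proof (cases "a = 0")
    case True
    have "poly_act G \<rho> g 0 = 0" by (rule polyfun_eqI) (simp add: eval_poly_act g)
    then have "rat_act G \<rho> g 0 = 0" using g by (simp add: Zero_fract_def)
    moreover have "q = 0" using True q by (simp add: Zero_fract_def eq_fract)
    ultimately show ?thesis by simp
  qed (use q nz in simp)
qed

lemma complex_adjoin_invariant_polys_subset:
  "complex_adjoin (ratfun_of ` invariant_polys_upto G \<rho> d) \<subseteq> invariant_ratfuns G \<rho>"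
  unfolding complex_adjoin_def
proof (rule field_generated_subset)
  show "range (\<lambda>c. ratfun_of (const_polyfun c)) \<union> ratfun_of ` invariant_polys_upto G \<rho> d
      \<subseteq> invariant_ratfuns G \<rho>"
    by (auto simp: ratfun_of_invariant_iff invariant_polys_upto_def)
  show "1 \<in> invariant_ratfuns G \<rho>"
    unfolding One_fract_def ratfun_of_invariant_iff by simp
qed (auto simp: invariant_ratfuns_def rat_act_add rat_act_mult rat_act_uminus rat_act_inverse)

end

text \<open>An eigenbasis is a parameter here; \<open>\<theta> b\<close> is the linear character of
  the group on the line through \<open>b\<close>.\<close>

locale diagonal_representation = complex_representation G \<rho>
  for G (structure) and \<rho> :: "'g \<Rightarrow> 'v::complex_vector \<Rightarrow> 'v" +
  fixes B :: "'v set" and \<theta> :: "'v \<Rightarrow> 'g \<Rightarrow> complex"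
  assumes finite_group: "finite (carrier G)"
    and finite_basis: "finite B" and independent: "cvec.independent B" and span: "cvec.span B = UNIV"
    and eigen: "g \<in> carrier G \<Longrightarrow> b \<in> B \<Longrightarrow> \<rho> g b = \<theta> b g *\<^sub>C b"
begin

definition coordinate :: "'v \<Rightarrow> 'v polyfun" where
  "coordinate b = Abs_polyfun (\<lambda>v. cvec.representation B v b)"

text \<open>Multisets serve as exponent vectors: \<open>size\<close> is the degree, and coordinates
  can be split off one at a time.\<close>

definition monomial :: "'v multiset \<Rightarrow> 'v polyfun" where
  "monomial M = (\<Prod>b\<in>#M. coordinate b)"

definition weight :: "'v multiset \<Rightarrow> 'g \<Rightarrow> complex" where
  "weight M g = (\<Prod>b\<in>#M. \<theta> b g)"

lemma linear_form_coordinate: "linear_form (\<lambda>v. cvec.representation B v b)"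
  using independent span by (rule cvec.linear_representation)

lemma eval_coordinate: "eval_polyfun (coordinate b) v = cvec.representation B v b"
proof -
  have "polynomial_upto 1 (\<lambda>v. cvec.representation B v b * 1)"
    using polynomial_upto.mult[OF linear_form_coordinate polynomial_upto.const[of 0 1]] by simp
  then show ?thesis unfolding coordinate_def by (subst Abs_polyfun_inverse) auto
qed

lemma coordinate_action:
  assumes g: "g \<in> carrier G" and b: "b \<in> B"
  shows "cvec.representation B (\<rho> g v) b = \<theta> b g * cvec.representation B v b"
proof -
  let ?r = "cvec.representation B"
  interpret T: Vector_Spaces.linear scaleC scaleC "\<rho> g" using g by (rule linear)
  have "v = (\<Sum>c\<in>B. ?r v c *\<^sub>C c)"
    using cvec.sum_representation_eq[OF independent _ finite_basis order_refl] span by simp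
  then have "\<rho> g v = (\<Sum>c\<in>B. ?r v c *\<^sub>C \<rho> g c)"
    by (metis (no_types, lifting) T.scale T.sum sum.cong)
  also have "\<dots> = (\<Sum>c\<in>B. (?r v c * \<theta> c g) *\<^sub>C c)"
    by (intro sum.cong) (simp_all add: eigen g)
  also have "?r \<dots> b = (\<Sum>c\<in>B. (?r v c * \<theta> c g) * ?r c b)"
    using independent span by (simp add: cvec.representation_sum cvec.representation_scale)
  also have "\<dots> = (\<Sum>c\<in>B. if c = b then ?r v c * \<theta> c g else 0)"
    by (intro sum.cong) (simp_all add: cvec.representation_basis independent)
  finally show ?thesis using b finite_basis by simp
qed

lemma monomial_simps [simp]:
  "monomial {#} = 1" "monomial (add_mset b M) = coordinate b * monomial M"
  "monomial (M + N) = monomial M * monomial N"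
  by (simp_all add: monomial_def)

lemma weight_simps [simp]:
  "weight {#} g = 1" "weight (add_mset b M) g = \<theta> b g * weight M g"
  "weight (M + N) g = weight M g * weight N g"
  by (simp_all add: weight_def)

lemma poly_act_monomial:
  assumes "g \<in> carrier G" "set_mset M \<subseteq> B"
  shows "poly_act G \<rho> (inv g) (monomial M) = const_polyfun (weight M g) * monomial M"
proof (rule polyfun_eqI)
  show "eval_polyfun (poly_act G \<rho> (inv g) (monomial M)) v
      = eval_polyfun (const_polyfun (weight M g) * monomial M) v" for v
    using assms(2)
    by (induction M) (simp_all add: eval_poly_act_inv assms(1) eval_coordinate coordinate_action)
qed

lemma theta_mult:
  assumes "g \<in> carrier G" "h \<in> carrier G" "b \<in> B"
  shows "\<theta> b (g \<otimes> h) = \<theta> b g * \<theta> b h"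
proof -
  interpret T: Vector_Spaces.linear scaleC scaleC "\<rho> g" using assms(1) by (rule linear)
  have "\<theta> b (g \<otimes> h) *\<^sub>C b = (\<theta> b g * \<theta> b h) *\<^sub>C b"
    using assms action_mult[of g h b] by (simp add: eigen T.scale mult.commute)
  moreover have "b \<noteq> 0" using assms independent cvec.dependent_zero by blast
  ultimately show ?thesis by simp
qed

lemma weight_mult:
  assumes "g \<in> carrier G" "h \<in> carrier G" "set_mset M \<subseteq> B"
  shows "weight M (g \<otimes> h) = weight M g * weight M h"
  using assms(3) by (induction M) (simp_all add: theta_mult assms(1,2))

lemma weight_one: "set_mset M \<subseteq> B \<Longrightarrow> weight M \<one> = 1"
proof (induction M)
  case (add b M)
  then have "\<one> \<in> carrier G" "b \<in> B" "b \<noteq> 0" using independent cvec.dependent_zero by auto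
  then have "\<theta> b \<one> = 1" using eigen[of \<one> b] by (metis action_one cvec.scale_right_imp_eq scaleC_one)
  then show ?case using add by simp
qed simp

lemma monomial_nonzero: "set_mset M \<subseteq> B \<Longrightarrow> monomial M \<noteq> 0"
proof (induction M)
  case (add b M)
  have "eval_polyfun (coordinate b) b = 1"
    using add.prems independent by (simp add: eval_coordinate cvec.representation_basis)
  then have "coordinate b \<noteq> 0" by auto
  then show ?case using add by simp
qed simp

lemma polynomial_upto_monomial:
  "set_mset M \<subseteq> B \<Longrightarrow> polynomial_upto (size M) (eval_polyfun (monomial M))"
proof (induction M)
  case empty
  then show ?case using polynomial_upto.const[of 0 1] by (simp add: one_polyfun.rep_eq)
next
  case (add b M)
  have "eval_polyfun (monomial (add_mset b M))
      = (\<lambda>v. cvec.representation B v b * eval_polyfun (monomial M) v)"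
    by (simp add: fun_eq_iff eval_coordinate)
  then show ?case using add polynomial_upto.mult[OF linear_form_coordinate] by simp
qed

lemma monomial_invariant_upto:
  assumes "set_mset M \<subseteq> B" "\<And>g. g \<in> carrier G \<Longrightarrow> weight M g = 1" "size M \<le> d"
  shows "monomial M \<in> invariant_polys_upto G \<rho> d"
proof -
  have one: "const_polyfun 1 = (1 :: 'v polyfun)" by (rule polyfun_eqI) simp
  have "poly_act G \<rho> g (monomial M) = monomial M" if "g \<in> carrier G" for g
    using poly_act_monomial[of "inv g" M] that assms by (simp add: one)
  then show ?thesis
    using assms polynomial_upto_monomial polynomial_upto_mono
    unfolding invariant_polys_upto_def by blast
qed

text \<open>Writing \<open>W'\<close> and \<open>N\<close> for short monomials with the weights of \<open>M\<close> and of the inverse of \<open>W\<close>, the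
  induction step is \<open>M x / W = (M / W') (W' x N) / (W N)\<close>, whose invariant factors have degree at most
  \<open>2 d + 1\<close>.\<close>

lemma monomial_quotient_mem:
  assumes cover: "\<And>M. set_mset M \<subseteq> B \<Longrightarrow>
      \<exists>W. set_mset W \<subseteq> B \<and> size W \<le> d \<and> (\<forall>g\<in>carrier G. weight W g = weight M g)"
    and M: "set_mset M \<subseteq> B" and W: "set_mset W \<subseteq> B" "size W \<le> d"
    and eq: "\<And>g. g \<in> carrier G \<Longrightarrow> weight W g = weight M g"
  shows "ratfun_of (monomial M) / ratfun_of (monomial W)
    \<in> complex_adjoin (ratfun_of ` invariant_polys_upto G \<rho> (2 * d + 1))" (is "_ \<in> ?K")
proof -
  have mem: "ratfun_of (monomial N) \<in> ?K"
    if "set_mset N \<subseteq> B" "\<And>g. g \<in> carrier G \<Longrightarrow> weight N g = 1" "size N \<le> 2 * d + 1" for N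
    unfolding complex_adjoin_def using monomial_invariant_upto[OF that] by (intro field_generated_incl) blast
  have nz: "ratfun_of (monomial N) \<noteq> 0" if "set_mset N \<subseteq> B" for N
    using monomial_nonzero[OF that] by (simp add: ratfun_of_eq_0_iff)
  have opposite: "\<exists>N. set_mset N \<subseteq> B \<and> size N \<le> d \<and> (\<forall>g\<in>carrier G. weight N g * weight U g = 1)"
    if U: "set_mset U \<subseteq> B" for U
  proof -
    \<comment> \<open>The weight of \<open>U\<close> has trivial |G|-th power, so its power |G| - 1
      is its inverse; \<open>cover\<close> then replaces this long monomial by one with at most
      \<open>d\<close> factors.\<close>
    let ?V = "repeat_mset (Coset.order G - 1) U"
    have "weight (repeat_mset n U) g = weight U (g [^] n)" if "g \<in> carrier G" for n g
      using that U by (induction n) (simp_all add: weight_one weight_mult)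
    moreover have "Coset.order G > 0" using finite_group order_gt_0_iff_finite by blast
    then have "g [^] (Coset.order G - 1) \<otimes> g = \<one>" if "g \<in> carrier G" for g
      using that pow_order_eq_1[OF that] nat_pow_Suc[of g "Coset.order G - 1"] by simp
    ultimately have "weight ?V g * weight U g = 1" if "g \<in> carrier G" for g
      using that U weight_mult[of "g [^] (Coset.order G - 1)" g U] by (simp add: weight_one)
    moreover have "set_mset ?V \<subseteq> B" using U by (auto simp flip: count_greater_zero_iff)
    ultimately show ?thesis using cover[of ?V] by metis
  qed
  have field_cancel: "m / w' * (x * (w' * n) / (w * n)) = x * m / w"
    if "w' \<noteq> 0" "n \<noteq> 0" for m w w' x n :: "'v ratfun"
    using that by (cases "w = 0") (simp_all add: field_simps)
  show ?thesis
    using M W eq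
  proof (induction M arbitrary: W)
    case empty
    then have "ratfun_of (monomial W) \<in> ?K" by (intro mem) auto
    moreover have "ratfun_of (monomial {#}) \<in> ?K" by (intro mem) auto
    ultimately show ?case unfolding complex_adjoin_def by (rule field_generated_divide[rotated])
  next
    case (add b M)
    obtain W' where W': "set_mset W' \<subseteq> B" "size W' \<le> d" "\<And>g. g \<in> carrier G \<Longrightarrow> weight W' g = weight M g"
      using cover[of M] add.prems by auto
    obtain N where N: "set_mset N \<subseteq> B" "size N \<le> d" "\<And>g. g \<in> carrier G \<Longrightarrow> weight N g * weight W g = 1"
      using opposite[of W] add.prems by auto
    have "ratfun_of (monomial M) / ratfun_of (monomial W') \<in> ?K"
      using add W' by simp
    \<comment> \<open>The weight of \<open>b\<close> and \<open>W'\<close> together is that of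
      \<open>add_mset b M\<close>, hence that of \<open>W\<close>, which \<open>N\<close> cancels.
      The count 1 + d + d gives the bound \<open>2 * d + 1\<close>.\<close>
    moreover have "ratfun_of (monomial (add_mset b (W' + N))) \<in> ?K"
      using add.prems W' N by (intro mem) (auto simp: mult.commute mult.left_commute)
    moreover have "ratfun_of (monomial (W + N)) \<in> ?K"
      using add.prems N by (intro mem) (auto simp: mult.commute)
    ultimately have "ratfun_of (monomial M) / ratfun_of (monomial W')
        * (ratfun_of (monomial (add_mset b (W' + N))) / ratfun_of (monomial (W + N))) \<in> ?K"
      unfolding complex_adjoin_def by (intro field_generated_mult[OF _ field_generated_divide])
    also have "ratfun_of (monomial M) / ratfun_of (monomial W')
        * (ratfun_of (monomial (add_mset b (W' + N))) / ratfun_of (monomial (W + N)))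
      = ratfun_of (monomial M) / ratfun_of (monomial W')
        * ((ratfun_of (coordinate b) * (ratfun_of (monomial W') * ratfun_of (monomial N)))
           / (ratfun_of (monomial W) * ratfun_of (monomial N)))"
      unfolding monomial_simps ratfun_of_mult ..
    also have "\<dots> = ratfun_of (coordinate b) * ratfun_of (monomial M) / ratfun_of (monomial W)"
      using nz[OF W'(1)] nz[OF N(1)] by (rule field_cancel)
    also have "\<dots> = ratfun_of (monomial (add_mset b M)) / ratfun_of (monomial W)"
      unfolding monomial_simps ratfun_of_mult ..
    finally show ?case .
  qed
qed

text \<open>The Reynolds operator, up to the factor |G|.\<close>

definition orbit_sum :: "'v polyfun \<Rightarrow> 'v polyfun" where
  "orbit_sum f = (\<Sum>g\<in>carrier G. poly_act G \<rho> (inv g) f)"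

lemma eval_orbit_sum: "eval_polyfun (orbit_sum f) v = (\<Sum>g\<in>carrier G. eval_polyfun f (\<rho> g v))"
  by (simp add: orbit_sum_def eval_polyfun_sum eval_poly_act_inv)

lemma orbit_sum_add: "orbit_sum (f + h) = orbit_sum f + orbit_sum h"
  by (rule polyfun_eqI) (simp add: eval_orbit_sum sum.distrib)

lemma orbit_sum_scale: "orbit_sum (const_polyfun c * f) = const_polyfun c * orbit_sum f"
  by (rule polyfun_eqI) (simp add: eval_orbit_sum sum_distrib_left)

lemma orbit_sum_monomial:
  assumes M: "set_mset M \<subseteq> B"
  shows "orbit_sum (monomial M) = const_polyfun (\<Sum>g\<in>carrier G. weight M g) * monomial M"
  by (rule polyfun_eqI)
     (simp add: orbit_sum_def eval_polyfun_sum poly_act_monomial M sum_distrib_right)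

lemma sum_right_translate:
  assumes h: "h \<in> carrier G"
  shows "(\<Sum>g\<in>carrier G. F (g \<otimes> h)) = (\<Sum>g\<in>carrier G. F g)"
  using h by (intro sum.reindex_bij_witness[of _ "\<lambda>g. g \<otimes> inv h" "\<lambda>g. g \<otimes> h"]) (auto simp: m_assoc)

text \<open>Translation by \<open>h\<close> multiplies the sum by \<open>weight M h\<close>, which
  is not 1. Averaging therefore kills every monomial that is not invariant.\<close>

lemma sum_weight_eq_0:
  assumes M: "set_mset M \<subseteq> B" and h: "h \<in> carrier G" "weight M h \<noteq> 1"
  shows "(\<Sum>g\<in>carrier G. weight M g) = 0"
proof -
  have "(\<Sum>g\<in>carrier G. weight M g) * weight M h = (\<Sum>g\<in>carrier G. weight M (g \<otimes> h))"
    by (simp add: weight_mult M h sum_distrib_right)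
  also have "\<dots> = (\<Sum>g\<in>carrier G. weight M g)" using h(1) by (rule sum_right_translate)
  finally show ?thesis using h(2) by simp
qed

text \<open>Polynomial functions are built from arbitrary linear forms; expanding each form in the
  basis \<open>B\<close> leaves only multiplication by single coordinates, scaling and
  addition.\<close>

lemma polyfun_induct_coordinate:
  assumes one: "P 1" and scale: "\<And>c f. P f \<Longrightarrow> P (const_polyfun c * f)"
    and add: "\<And>f h. P f \<Longrightarrow> P h \<Longrightarrow> P (f + h)"
    and coordinate: "\<And>b f. b \<in> B \<Longrightarrow> P f \<Longrightarrow> P (coordinate b * f)"
  shows "P f"
proof -
  have zero: "P 0"
  proof -
    have "const_polyfun 0 * 1 = (0 :: 'v polyfun)" by (rule polyfun_eqI) simp
    then show ?thesis using scale[OF one, of 0] by simp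
  qed
  have sum: "P (sum F I)" if "\<And>i. i \<in> I \<Longrightarrow> P (F i)" for F and I :: "'v set"
    using that by (induction I rule: infinite_finite_induct) (auto intro: zero add)
  have "P f" if "polynomial_upto d F" "eval_polyfun f = F" for d F f
    using that
  proof (induction arbitrary: f)
    case (const d k)
    then have "f = const_polyfun k * 1" by (intro polyfun_eqI) simp
    then show ?case using scale[OF one] by simp
  next
    case (add d F H)
    have ev: "eval_polyfun (Abs_polyfun F) = F" "eval_polyfun (Abs_polyfun H) = H"
      using add.hyps Abs_polyfun_inverse by blast+
    then have "f = Abs_polyfun F + Abs_polyfun H"
      using add.prems by (intro polyfun_eqI) simp
    then show ?case using add.IH ev assms(3) by simp
  next
    case (mult l d F)
    interpret l: Vector_Spaces.linear scaleC "(*)" l by (rule mult)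
    have expand: "l v = (\<Sum>b\<in>B. l b * cvec.representation B v b)" for v
    proof -
      have "v = (\<Sum>b\<in>B. cvec.representation B v b *\<^sub>C b)"
        using cvec.sum_representation_eq[OF independent _ finite_basis order_refl] span by simp
      then have "l v = (\<Sum>b\<in>B. l (cvec.representation B v b *\<^sub>C b))" by (metis l.sum)
      then show ?thesis by (simp add: l.scale mult.commute)
    qed
    have ev: "eval_polyfun (Abs_polyfun F) = F"
      using mult.hyps Abs_polyfun_inverse by blast
    have "f = (\<Sum>b\<in>B. const_polyfun (l b) * (coordinate b * Abs_polyfun F))"
    proof (rule polyfun_eqI)
      fix v
      have "eval_polyfun f v = (\<Sum>b\<in>B. l b * cvec.representation B v b) * F v"
        using mult.prems expand[of v] by simp
      then show "eval_polyfun f v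
          = eval_polyfun (\<Sum>b\<in>B. const_polyfun (l b) * (coordinate b * Abs_polyfun F)) v"
        by (simp only: eval_polyfun_sum eval_polyfun_simps eval_coordinate ev sum_distrib_right mult.assoc)
    qed
    moreover have "P (\<Sum>b\<in>B. const_polyfun (l b) * (coordinate b * Abs_polyfun F))"
      by (intro sum scale coordinate mult.IH[OF ev])
    ultimately show ?case by simp
  qed
  moreover obtain d where "polynomial_upto d (eval_polyfun f)" using eval_polyfun[of f] by blast
  ultimately show ?thesis by blast
qed

text \<open>The product of the conjugates of \<open>f\<close> other than \<open>f\<close> itself, so that \<open>f * orbit_cofactor f\<close> is the
  norm of \<open>f\<close>.\<close>

definition orbit_cofactor :: "'v polyfun \<Rightarrow> 'v polyfun" where
  "orbit_cofactor f = (\<Prod>g\<in>carrier G - {\<one>}. poly_act G \<rho> (inv g) f)"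

lemma mult_orbit_cofactor: "f * orbit_cofactor f = (\<Prod>g\<in>carrier G. poly_act G \<rho> (inv g) f)"
proof -
  have "poly_act G \<rho> (inv \<one>) f = f"
    by (rule polyfun_eqI) (simp only: eval_poly_act_inv[OF one_closed] action_one)
  then show ?thesis
    unfolding orbit_cofactor_def by (subst (2) prod.remove[of _ \<one>]) (simp_all add: finite_group)
qed

text \<open>Right translation permutes the factors of the norm, so the norm is invariant and each
  group element contributes it once. This supplies an orbit sum that does not vanish.\<close>

lemma orbit_sum_mult_cofactor:
  "orbit_sum (f * orbit_cofactor f)
    = const_polyfun (of_nat (Coset.order G)) * (f * orbit_cofactor f)"
proof (rule polyfun_eqI)
  fix v
  have "eval_polyfun (f * orbit_cofactor f) (\<rho> h v) = eval_polyfun (f * orbit_cofactor f) v"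
    if h: "h \<in> carrier G" for h
  proof -
    have "eval_polyfun (f * orbit_cofactor f) (\<rho> h v)
        = (\<Prod>g\<in>carrier G. eval_polyfun f (\<rho> (g \<otimes> h) v))"
      unfolding mult_orbit_cofactor by (simp add: eval_polyfun_prod eval_poly_act_inv action_mult h)
    also have "\<dots> = (\<Prod>g\<in>carrier G. eval_polyfun f (\<rho> g v))"
      using h by (intro prod.reindex_bij_witness[of _ "\<lambda>g. g \<otimes> inv h" "\<lambda>g. g \<otimes> h"])
        (auto simp: m_assoc)
    also have "\<dots> = eval_polyfun (f * orbit_cofactor f) v"
      unfolding mult_orbit_cofactor by (simp add: eval_polyfun_prod eval_poly_act_inv)
    finally show ?thesis .
  qed
  then show "eval_polyfun (orbit_sum (f * orbit_cofactor f)) v = eval_polyfun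
      (const_polyfun (of_nat (Coset.order G)) * (f * orbit_cofactor f)) v"
    unfolding eval_orbit_sum by (simp add: Coset.order_def del: eval_polyfun_simps(5)) simp
qed

lemma orbit_cofactor_nonzero:
  assumes "f \<noteq> 0" shows "f * orbit_cofactor f \<noteq> 0"
proof -
  have "poly_act G \<rho> (inv g) f \<noteq> 0" if "g \<in> carrier G" for g
    using assms poly_act_eq_0 that by blast
  then show ?thesis unfolding mult_orbit_cofactor by (simp add: finite_group)
qed

text \<open>Invariance gives that \<open>b\<close> times a conjugate of \<open>a\<close> equals
  \<open>a\<close> times the same conjugate of \<open>b\<close>; multiply by that conjugate of
  \<open>c\<close> and sum over the group. Thus the fraction survives averaging of numerator and
  denominator if the new denominator is nonzero.\<close>

lemma orbit_sum_invariant_ratio: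
  assumes inv: "Fract a b \<in> invariant_ratfuns G \<rho>" and b: "b \<noteq> 0"
  shows "b * orbit_sum (a * c) = a * orbit_sum (b * c)"
proof (rule polyfun_eqI)
  fix v
  have "eval_polyfun b v * eval_polyfun a (\<rho> g v) = eval_polyfun a v * eval_polyfun b (\<rho> g v)"
    if g: "g \<in> carrier G" for g
  proof -
    have "poly_act G \<rho> (inv g) b \<noteq> 0" using b poly_act_eq_0[of "inv g"] g by auto
    moreover have "Fract (poly_act G \<rho> (inv g) a) (poly_act G \<rho> (inv g) b) = Fract a b"
      using inv b g rat_act_Fract[of "inv g" b a] by (simp add: invariant_ratfuns_def)
    ultimately have "poly_act G \<rho> (inv g) a * b = a * poly_act G \<rho> (inv g) b"
      using b by (simp add: eq_fract)
    from arg_cong[OF this, of "\<lambda>f. eval_polyfun f v"] show ?thesis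
      using g by (simp add: eval_poly_act_inv mult.commute)
  qed
  then show "eval_polyfun (b * orbit_sum (a * c)) v = eval_polyfun (a * orbit_sum (b * c)) v"
    by (simp add: eval_orbit_sum sum_distrib_left flip: mult.assoc)
qed

lemma invariant_ratfuns_generated:
  assumes cover: "\<And>M. set_mset M \<subseteq> B \<Longrightarrow>
      \<exists>W. set_mset W \<subseteq> B \<and> size W \<le> d \<and> (\<forall>g\<in>carrier G. weight W g = weight M g)"
  shows "complex_adjoin (ratfun_of ` invariant_polys_upto G \<rho> (2 * d + 1)) = invariant_ratfuns G \<rho>"
    (is "?K = _")
proof
  have const: "ratfun_of (const_polyfun c) \<in> ?K" for c
    unfolding complex_adjoin_def by (rule field_generated_incl) simp
  \<comment> \<open>\<open>M\<close> collects the coordinates split off from \<open>f\<close>, so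
    that the induction ends at a bare monomial.\<close>
  have orbit_sum_mem: "ratfun_of (orbit_sum (f * monomial M)) \<in> ?K" if "set_mset M \<subseteq> B" for f M
    using that
  proof (induction f arbitrary: M rule: polyfun_induct_coordinate)
    case (1 M)
    show ?case
    proof (cases "\<forall>h\<in>carrier G. weight M h = 1")
      case True
      then have "ratfun_of (monomial M) \<in> ?K"
        \<comment> \<open>For trivial weight the empty monomial, which is 1, is an admissible
          denominator.\<close>
        using monomial_quotient_mem[OF cover 1, of "{#}"] by (simp flip: One_fract_def)
      then show ?thesis using const 1 unfolding complex_adjoin_def
        by (simp add: orbit_sum_monomial ratfun_of_mult field_generated_mult del: mult_fract)
    next
      case False
      then have "orbit_sum (monomial M) = const_polyfun 0 * monomial M"
        using sum_weight_eq_0[OF 1] orbit_sum_monomial[OF 1] by metis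
      also have "\<dots> = const_polyfun 0" by (rule polyfun_eqI) simp
      finally show ?thesis using const by simp
    qed
  next
    case (2 c f)
    then show ?case using const unfolding complex_adjoin_def
      by (simp add: mult.assoc orbit_sum_scale ratfun_of_mult field_generated_mult del: mult_fract)
  next
    case (3 f h)
    then show ?case unfolding complex_adjoin_def
      by (simp add: distrib_right orbit_sum_add ratfun_of_add field_generated_add del: add_fract)
  next
    case (4 b f)
    then show ?case using "4.IH"[of "add_mset b M"] by (simp add: ac_simps)
  qed
  have mem: "ratfun_of (orbit_sum f) \<in> ?K" for f
    using orbit_sum_mem[of "{#}" f] by simp
  show "invariant_ratfuns G \<rho> \<subseteq> ?K"
  proof
    fix q assume q: "q \<in> invariant_ratfuns G \<rho>"
    obtain a b where ab: "q = Fract a b" "b \<noteq> 0" by (cases q)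
    \<comment> \<open>The average of \<open>b\<close> alone may vanish; this \<open>c\<close> turns
      \<open>b * c\<close> into the norm of \<open>b\<close>, whose orbit sum is a nonzero multiple
      of itself.\<close>
    define c where "c = orbit_cofactor b"
    have "orbit_sum (b * c) \<noteq> 0"
    proof
      assume "orbit_sum (b * c) = 0"
      moreover have "b * c \<noteq> 0" using orbit_cofactor_nonzero[OF ab(2)] by (simp add: c_def)
      ultimately have "const_polyfun (of_nat (Coset.order G)) = (0 :: 'v polyfun)"
        using orbit_sum_mult_cofactor[of b] by (simp add: c_def)
      from arg_cong[OF this, of "\<lambda>f. eval_polyfun f 0"] show False
        using finite_group order_gt_0_iff_finite by simp
    qed
    moreover have "b * orbit_sum (a * c) = a * orbit_sum (b * c)"
      using orbit_sum_invariant_ratio q ab by simp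
    ultimately have "q = ratfun_of (orbit_sum (a * c)) / ratfun_of (orbit_sum (b * c))"
      using ab by (simp add: eq_fract mult.commute)
    then show "q \<in> ?K"
      using mem unfolding complex_adjoin_def by (simp only: field_generated_divide)
  qed
qed (rule complex_adjoin_invariant_polys_subset)

end

section \<open>The degree of the character field\<close>

lemma int_poly_eval_degree_bound:
  assumes "F \<noteq> 0" "finite R" "\<And>x. x \<in> R \<Longrightarrow> int_poly_eval F x = 0"
  shows "card R \<le> degree F"
proof -
  let ?F = "map_poly of_int F :: complex poly"
  have nz: "?F \<noteq> 0" using assms(1) by (simp add: map_poly_eq_0_iff)
  have "card R \<le> card {x. poly ?F x = 0}"
    using assms(3) by (intro card_mono poly_roots_finite[OF nz]) (auto simp: int_poly_eval_def)
  also have "\<dots> \<le> degree ?F" by (rule card_poly_roots_bound[OF nz])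
  also have "\<dots> = degree F" by (simp add: degree_map_poly)
  finally show ?thesis .
qed

text \<open>The field Q(zeta), with one integer denominator for each element.\<close>

definition cyclotomic_numbers :: "nat \<Rightarrow> complex set" where
  "cyclotomic_numbers p = {int_poly_eval F (root_of_unity p) / of_int c |F c. c \<noteq> 0}"

lemma cyclotomic_numbersI: "c \<noteq> 0 \<Longrightarrow> int_poly_eval F (root_of_unity p) / of_int c \<in> cyclotomic_numbers p"
  unfolding cyclotomic_numbers_def by blast

lemma int_poly_eval_in_cyclotomic_numbers: "int_poly_eval F (root_of_unity p) \<in> cyclotomic_numbers p"
  using cyclotomic_numbersI[of 1 F p] by simp

text \<open>Only inverses need an argument: if \<open>U\<close> times \<open>F\<close> takes a
  nonzero integer value e at zeta, then c U / e inverts F / c.\<close>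

lemma rat_adjoin_cyclotomic:
  assumes p: "prime p" and S: "S \<subseteq> cyclotomic_numbers p"
  shows "rat_adjoin S \<subseteq> cyclotomic_numbers p"
  unfolding rat_adjoin_def
proof (rule field_generated_subset)
  have "x \<in> cyclotomic_numbers p" if x: "x \<in> \<rat>" for x
  proof -
    obtain a b where "b > 0" "coprime a b" "x = of_int a / of_int b" using x by (rule Rats_cases')
    then show ?thesis using cyclotomic_numbersI[of b "[:a:]" p] by simp
  qed
  then show "\<rat> \<union> S \<subseteq> cyclotomic_numbers p" using S by blast
  show "1 \<in> cyclotomic_numbers p" using int_poly_eval_in_cyclotomic_numbers[of 1] by simp
next
  fix x assume "x \<in> cyclotomic_numbers p"
  then obtain F c where F: "c \<noteq> 0" "x = int_poly_eval F (root_of_unity p) / of_int c"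
    unfolding cyclotomic_numbers_def by blast
  show "- x \<in> cyclotomic_numbers p"
    using cyclotomic_numbersI[OF F(1), of "- F" p] F by simp
  assume "x \<noteq> 0"
  with F have nz: "int_poly_eval F (root_of_unity p) \<noteq> 0" by auto
  show "inverse x \<in> cyclotomic_numbers p"
  proof -
    obtain U e where U: "e \<noteq> 0"
      "int_poly_eval U (root_of_unity p) * int_poly_eval F (root_of_unity p) = of_int e"
      using root_of_unity_poly_inverse[OF p nz] .
    moreover from U have "int_poly_eval U (root_of_unity p) \<noteq> 0" by auto
    ultimately have "inverse x = int_poly_eval (smult c U) (root_of_unity p) / of_int e"
      using nz by (simp add: F(2) flip: U(2))
    then show ?thesis using cyclotomic_numbersI[OF U(1), of "smult c U" p] by (simp only:)
  qed
next
  fix x y assume "x \<in> cyclotomic_numbers p" "y \<in> cyclotomic_numbers p"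
  then obtain F c H e where F: "c \<noteq> 0" "x = int_poly_eval F (root_of_unity p) / of_int c"
    and H: "e \<noteq> 0" "y = int_poly_eval H (root_of_unity p) / of_int e"
    unfolding cyclotomic_numbers_def by blast
  have "x + y = int_poly_eval (smult e F + smult c H) (root_of_unity p) / of_int (c * e)"
    using F H by (simp add: field_simps)
  then show "x + y \<in> cyclotomic_numbers p"
    using cyclotomic_numbersI[of "c * e" "smult e F + smult c H" p] F(1) H(1) by simp
  have "x * y = int_poly_eval (F * H) (root_of_unity p) / of_int (c * e)"
    using F H by simp
  then show "x * y \<in> cyclotomic_numbers p"
    using cyclotomic_numbersI[of "c * e" "F * H" p] F(1) H(1) by simp
qed

global_interpretation rat_cvec: vector_space "\<lambda>(q::rat) (z::complex). of_rat q * z"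
  by unfold_locales (simp_all add: algebra_simps of_rat_add of_rat_mult)

text \<open>Exponents can be reduced modulo \<open>p\<close>; this yields the finite dimension on
  which the meaning of \<open>rat_degree\<close> depends.\<close>

lemma cyclotomic_numbers_span:
  assumes "p > 0"
  shows "cyclotomic_numbers p \<subseteq> rat_cvec.span ((\<lambda>i. root_of_unity p ^ i) ` {..<p})"
proof
  fix x assume "x \<in> cyclotomic_numbers p"
  then obtain F c where F: "c \<noteq> 0" "x = int_poly_eval F (root_of_unity p) / of_int c"
    unfolding cyclotomic_numbers_def by blast
  then have "x = (\<Sum>i\<le>degree F. of_rat (of_int (coeff F i) / of_int c) * root_of_unity p ^ (i mod p))"
    by (simp add: int_poly_eval_altdef sum_divide_distrib of_rat_divide root_of_unity_power_mod assms)
  also have "\<dots> \<in> rat_cvec.span ((\<lambda>i. root_of_unity p ^ i) ` {..<p})"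
    using assms by (intro rat_cvec.span_sum rat_cvec.span_scale rat_cvec.span_base) auto
  finally show "x \<in> rat_cvec.span ((\<lambda>i. root_of_unity p ^ i) ` {..<p})" .
qed

lemma common_denominator:
  fixes q :: "nat \<Rightarrow> rat"
  obtains D c where "D \<noteq> 0" "\<And>i. i < N \<Longrightarrow> of_int D * q i = of_int (c i)"
proof -
  have "\<exists>D c. D \<noteq> 0 \<and> (\<forall>i<N. of_int D * q i = of_int (c i))"
  proof (induction N)
    case 0
    show ?case by (rule exI[of _ 1]) simp
  next
    case (Suc N)
    then obtain D c where D: "D \<noteq> 0" "\<forall>i<N. of_int D * q i = of_int (c i)" by blast
    obtain a b where ab: "b > 0" "q N = of_int a / of_int b"
      by (metis Fract_of_int_quotient quotient_of_denom_pos quotient_of_div surj_pair)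
    have "of_int (D * b) * q i = of_int (if i = N then D * a else b * c i)" if "i < Suc N" for i
    proof (cases "i = N")
      case True
      then show ?thesis using ab by (simp add: field_simps)
    next
      case False
      then have "of_int D * q i = of_int (c i)" using D that by simp
      then show ?thesis using False by simp
    qed
    then show ?case using D(1) ab(1)
      by (intro exI[of _ "D * b"] exI[of _ "\<lambda>i. if i = N then D * a else b * c i"]) auto
  qed
  then show thesis using that by blast
qed

text \<open>\<open>R\<close> plays the part of the conjugates of \<open>x\<close>. A nonzero integer
  polynomial vanishing at \<open>x\<close> vanishes on \<open>R\<close>, so its degree is at least
  \<open>card R\<close>; hence the first \<open>card R\<close> powers of \<open>x\<close> are
  independent over the rationals.\<close>

lemma card_conjugates_le_rat_degree:
  assumes p: "prime p" and S: "S \<subseteq> cyclotomic_numbers p" and x: "x \<in> S"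
    and R: "finite R" "\<And>F y. int_poly_eval F x = 0 \<Longrightarrow> y \<in> R \<Longrightarrow> int_poly_eval F y = 0"
  shows "card R \<le> rat_degree (rat_adjoin S)"
proof -
  let ?N = "card R" and ?K = "rat_adjoin S"
  have bound: "F = 0" if "int_poly_eval F x = 0" "degree F < ?N" for F
    using int_poly_eval_degree_bound[of F R] R that by (meson not_less)
  \<comment> \<open>Independence is a property of the set of powers, so their distinctness has to be
    known for the count.\<close>
  have inj: "inj_on (\<lambda>i. x ^ i) {..<?N}"
  proof (rule inj_onI)
    fix i j assume ij: "i \<in> {..<?N}" "j \<in> {..<?N}" "x ^ i = x ^ j"
    let ?F = "monom 1 i - monom 1 j :: int poly"
    have "int_poly_eval ?F x = 0"
      using ij by (simp only: diff_conv_add_uminus int_poly_eval_add int_poly_eval_uminus) simp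
    moreover have "degree ?F < ?N"
      using ij by (intro degree_diff_less) (auto intro: le_less_trans[OF degree_monom_le])
    ultimately have "?F = 0" by (rule bound)
    then have "coeff (monom 1 i :: int poly) i = coeff (monom 1 j) i" by simp
    then show "i = j" by (simp split: if_splits)
  qed
  have ind: "rat_cvec.independent ((\<lambda>i. x ^ i) ` {..<?N})"
  proof (rule rat_cvec.independent_if_scalars_zero)
    fix f y assume sum: "(\<Sum>y\<in>(\<lambda>i. x ^ i) ` {..<?N}. of_rat (f y) * y) = 0" and "y \<in> (\<lambda>i. x ^ i) ` {..<?N}"
    then obtain i where i: "i < ?N" "y = x ^ i" by auto
    obtain D c where D: "D \<noteq> 0" "\<And>i. i < ?N \<Longrightarrow> of_int D * f (x ^ i) = of_int (c i)"
      using common_denominator[of ?N "\<lambda>i. f (x ^ i)"] by blast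
    let ?F = "\<Sum>i<?N. monom (c i) i"
    have "int_poly_eval ?F x = (\<Sum>i<?N. of_rat (of_int D * f (x ^ i)) * x ^ i)"
      unfolding int_poly_eval_sum by (intro sum.cong) (simp_all only: D(2) int_poly_eval_simps lessThan_iff of_rat_of_int_eq)
    also have "\<dots> = of_int D * (\<Sum>i<?N. of_rat (f (x ^ i)) * x ^ i)"
      by (simp add: sum_distrib_left of_rat_mult mult.assoc)
    also have "(\<Sum>i<?N. of_rat (f (x ^ i)) * x ^ i) = 0"
      using sum by (simp add: sum.reindex[OF inj])
    finally have "int_poly_eval ?F x = 0" by simp
    moreover have "degree ?F < ?N"
      using i by (intro degree_sum_less) (auto intro: le_less_trans[OF degree_monom_le])
    ultimately have "?F = 0" by (rule bound)
    then have "coeff ?F i = 0" by simp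
    then have "c i = 0" using i by (simp add: coeff_sum)
    then show "f y = 0" using D(1) D(2)[OF i(1)] i by simp
  qed simp
  have pow: "(\<lambda>i. x ^ i) ` {..<?N} \<subseteq> ?K"
    using field_generated_power[OF field_generated_incl[of x "\<rat> \<union> S"]] x unfolding rat_adjoin_def by auto
  obtain C where C: "(\<lambda>i. x ^ i) ` {..<?N} \<subseteq> C" "C \<subseteq> ?K" "rat_cvec.independent C" "?K \<subseteq> rat_cvec.span C"
    using rat_cvec.maximal_independent_subset_extend[OF pow ind] by blast
  have "C \<subseteq> rat_cvec.span ((\<lambda>i. root_of_unity p ^ i) ` {..<p})"
    using C(2) rat_adjoin_cyclotomic[OF p S] cyclotomic_numbers_span prime_gt_0_nat[OF p] by blast
  then have "finite C"
    using rat_cvec.independent_span_bound[OF _ C(3)] by blast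
  then have "card ((\<lambda>i. x ^ i) ` {..<?N}) \<le> card C" using C(1) by (rule card_mono)
  also have "card C = rat_degree ?K"
    unfolding rat_degree_def using C by (intro rat_cvec.basis_card_eq_dim) auto
  finally show ?thesis by (simp add: card_image[OF inj])
qed

lemma mult_mod_cancel_prime:
  fixes p k :: nat
  assumes "prime p" "\<not> p dvd k"
  shows "k * x mod p = k * y mod p \<longleftrightarrow> x mod p = y mod p"
proof
  assume "k * x mod p = k * y mod p"
  then have "(x mod p) * k mod p = (y mod p) * k mod p" by (simp add: mod_simps mult.commute)
  moreover have "x mod p \<in> {..<p}" "y mod p \<in> {..<p}" using prime_gt_0_nat[OF assms(1)] by simp_all
  ultimately show "x mod p = y mod p" using inj_onD[OF inj_on_mult_mod_prime[OF assms]] by blast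
qed (metis mod_mult_right_eq)

section \<open>Character values of a cyclic group and the multiplicities of its weights\<close>

context
  fixes p :: nat and B :: "'b set" and a :: "'b \<Rightarrow> nat"
  assumes p: "prime p" and B: "finite B"
begin

text \<open>The character at the \<open>k\<close>-th power of a generator that acts on
  \<open>b\<close> with eigenvalue zeta^(a b).\<close>

definition power_trace :: "nat \<Rightarrow> complex" where
  "power_trace k = (\<Sum>b\<in>B. root_of_unity p ^ (k * a b))"

text \<open>The residues \<open>h\<close> for which the automorphism raising the root of unity to the \<open>h\<close>-th power fixes
  \<open>power_trace 1\<close>.\<close>

definition multiplicity_stabilizer :: "nat set" where
  "multiplicity_stabilizer = {h \<in> {0<..<p}. \<forall>r.
     card {b \<in> B. a b mod p = h * r mod p} = card {b \<in> B. a b mod p = r mod p}}"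

text \<open>With exponents reduced modulo \<open>p\<close>, both traces come from integer
  polynomials of degree below \<open>p\<close>. Their difference vanishes at zeta, hence at all
  nontrivial p-th roots of unity by conjugation, and also at 1, where both count \<open>B\<close>.
  With \<open>p\<close> roots it is 0, and the coefficients are the multiplicities.\<close>

lemma power_trace_eq_imp_card_eq:
  assumes eq: "power_trace k = power_trace l" and r: "r < p"
  shows "card {b \<in> B. k * a b mod p = r} = card {b \<in> B. l * a b mod p = r}"
proof -
  have p0: "p > 0" using p by (rule prime_gt_0_nat)
  let ?P = "\<lambda>k. \<Sum>b\<in>B. monom 1 (k * a b mod p) :: int poly"
  let ?F = "?P k - ?P l"
  have coeff_P: "coeff (?P k) r = int (card {b \<in> B. k * a b mod p = r})" for k r
    using B by (simp add: coeff_sum sum.If_cases Int_def)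
  have "int_poly_eval (?P k) (root_of_unity p) = power_trace k" for k
    by (simp add: int_poly_eval_sum power_trace_def root_of_unity_power_mod p0)
  then have root: "int_poly_eval ?F (root_of_unity p) = 0"
    using eq by (simp only: diff_conv_add_uminus int_poly_eval_add int_poly_eval_uminus) simp
  have "int_poly_eval ?F y = 0" if y: "y \<in> (\<lambda>j. root_of_unity p ^ j) ` {..<p}" for y
  proof -
    obtain j where j: "j < p" "y = root_of_unity p ^ j" using y by blast
    show ?thesis
    proof (cases "j = 0")
      case True
      then show ?thesis using j
        by (simp only: diff_conv_add_uminus int_poly_eval_add int_poly_eval_uminus int_poly_eval_sum) simp
    next
      case False
      then show ?thesis using root_of_unity_conjugate[OF p root, of j] j by (simp add: nat_dvd_not_less)
    qed
  qed
  moreover have "card ((\<lambda>j. root_of_unity p ^ j) ` {..<p}) = p"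
    using p0 by (subst card_image) (auto intro!: inj_onI simp: root_of_unity_power_eq_iff)
  moreover have "degree ?F < p"
    using p0 by (intro degree_diff_less degree_sum_less) (auto intro: le_less_trans[OF degree_monom_le])
  ultimately have "?F = 0"
    using int_poly_eval_degree_bound[of ?F "(\<lambda>j. root_of_unity p ^ j) ` {..<p}"] by fastforce
  then have "coeff (?P k) r = coeff (?P l) r" by simp
  then show ?thesis unfolding coeff_P by simp
qed

text \<open>Write k = h l modulo \<open>p\<close>. Equal traces give \<open>k * a\<close> and
  \<open>l * a\<close> the same multiplicities; at the residue k r = l (h r) this compares the
  multiplicities of \<open>r\<close> and \<open>h * r\<close> in \<open>a\<close>.\<close>

lemma power_trace_fibre:
  assumes k: "k \<in> {0<..<p}" and l: "l \<in> {0<..<p}" and eq: "power_trace k = power_trace l"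
  shows "k \<in> (\<lambda>h. h * l mod p) ` multiplicity_stabilizer"
proof -
  have kl: "\<not> p dvd k" "\<not> p dvd l" using k l by (auto simp: nat_dvd_not_less)
  have "(\<lambda>h. h * l mod p) ` {..<p} = {..<p}"
    using l by (intro endo_inj_surj inj_on_mult_mod_prime[OF p kl(2)]) auto
  moreover have "k \<in> {..<p}" using k by simp
  ultimately have "k \<in> (\<lambda>h. h * l mod p) ` {..<p}" by (simp only:)
  then obtain h where h: "h < p" "k = h * l mod p" by (elim imageE) simp
  then have "h \<noteq> 0" using k by (intro notI) simp
  have "card {b \<in> B. a b mod p = h * r mod p} = card {b \<in> B. a b mod p = r mod p}" for r
  proof -
    have kr: "k * r mod p = l * (h * r) mod p" by (simp add: h(2) mod_simps ac_simps)
    have "card {b \<in> B. a b mod p = r mod p} = card {b \<in> B. k * a b mod p = k * r mod p}"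
      by (simp add: mult_mod_cancel_prime[OF p kl(1)])
    also have "\<dots> = card {b \<in> B. l * a b mod p = k * r mod p}"
      using k by (intro power_trace_eq_imp_card_eq[OF eq]) auto
    also have "\<dots> = card {b \<in> B. a b mod p = h * r mod p}"
      unfolding kr by (simp add: mult_mod_cancel_prime[OF p kl(2)])
    finally show ?thesis ..
  qed
  then have "h \<in> multiplicity_stabilizer"
    using h \<open>h \<noteq> 0\<close> by (simp add: multiplicity_stabilizer_def)
  then show ?thesis using h(2) by blast
qed

lemma card_power_traces:
  "p - 1 \<le> card (power_trace ` {0<..<p}) * card multiplicity_stabilizer"
proof -
  have fin: "finite multiplicity_stabilizer" by (simp add: multiplicity_stabilizer_def)
  have fibre: "card {k \<in> {0<..<p}. power_trace k = y} \<le> card multiplicity_stabilizer"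
    if y: "y \<in> power_trace ` {0<..<p}" for y
  proof -
    obtain l where l: "l \<in> {0<..<p}" "y = power_trace l" using y by blast
    then have "{k \<in> {0<..<p}. power_trace k = y} \<subseteq> (\<lambda>h. h * l mod p) ` multiplicity_stabilizer"
      using power_trace_fibre by blast
    then show ?thesis using card_mono[OF finite_imageI[OF fin]] card_image_le[OF fin] le_trans by blast
  qed
  have "{0<..<p} = (\<Union>y\<in>power_trace ` {0<..<p}. {k \<in> {0<..<p}. power_trace k = y})" by blast
  then have "p - 1 = card (\<Union>y\<in>power_trace ` {0<..<p}. {k \<in> {0<..<p}. power_trace k = y})"
    by (metis card_greaterThanLessThan diff_Suc_eq_diff_pred diff_zero One_nat_def)
  also have "\<dots> \<le> (\<Sum>y\<in>power_trace ` {0<..<p}. card {k \<in> {0<..<p}. power_trace k = y})"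
    by (rule card_UN_le) simp
  also have "\<dots> \<le> card (power_trace ` {0<..<p}) * card multiplicity_stabilizer"
    using sum_bounded_above[OF fibre] by simp
  finally show ?thesis .
qed

text \<open>One integer polynomial takes the value \<open>power_trace k\<close> at every zeta^k.
  Composed with it, a relation for \<open>power_trace 1\<close> becomes a relation at zeta, which
  conjugation carries to zeta^k.\<close>

lemma card_power_traces_le_rat_degree:
  "card (power_trace ` {0<..<p}) \<le> rat_degree (rat_adjoin (range power_trace))"
proof (rule card_conjugates_le_rat_degree[OF p])
  let ?X = "\<lambda>k. \<Sum>b\<in>B. monom 1 (k * a b) :: int poly"
  have X: "int_poly_eval (?X l) (root_of_unity p ^ k) = power_trace (k * l)" for k l
    by (simp add: int_poly_eval_sum power_trace_def mult.assoc flip: power_mult)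
  show "range power_trace \<subseteq> cyclotomic_numbers p"
    using X[of _ 1] int_poly_eval_in_cyclotomic_numbers by (metis (no_types, lifting) image_subsetI mult_1 power_one_right)
  show "power_trace 1 \<in> range power_trace" by simp
  fix F y assume F: "int_poly_eval F (power_trace 1) = 0" and "y \<in> power_trace ` {0<..<p}"
  then obtain k where k: "k \<in> {0<..<p}" "y = power_trace k" by blast
  have "int_poly_eval (pcompose F (?X 1)) (root_of_unity p) = 0"
    using X[of 1 1] F by simp
  then have "int_poly_eval (pcompose F (?X 1)) (root_of_unity p ^ k) = 0"
    using k by (intro root_of_unity_conjugate[OF p]) (auto simp: nat_dvd_not_less)
  then show "int_poly_eval F y = 0" using X[of 1 k] k by simp
qed simp

lemma short_congruent_multiset:
  assumes d: "rat_degree (rat_adjoin (range power_trace)) \<le> d" and M: "set_mset M \<subseteq> B"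
  shows "\<exists>W. set_mset W \<subseteq> B \<and> size W \<le> d \<and> (\<Sum>b\<in>#W. a b) mod p = (\<Sum>b\<in>#M. a b) mod p"
proof -
  have p0: "p > 0" using p by (rule prime_gt_0_nat)
  let ?A = "(\<lambda>b. a b mod p) ` B"
  \<comment> \<open>The sumset argument sees only the set of residues that occur; each residue is
    traded back for a basis vector carrying it.\<close>
  have lift: "\<exists>W. set_mset W \<subseteq> B \<and> size W = size N \<and> (\<Sum>b\<in>#W. a b) mod p = sum_mset N mod p"
    if "set_mset N \<subseteq> ?A" for N
    using that
  proof (induction N)
    case (add x N)
    then obtain W b where W: "set_mset W \<subseteq> B" "size W = size N" "(\<Sum>b\<in>#W. a b) mod p = sum_mset N mod p"
      and b: "b \<in> B" "x = a b mod p" by auto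
    have "(\<Sum>b\<in>#add_mset b W. a b) mod p = (a b mod p + (\<Sum>b\<in>#W. a b) mod p) mod p"
      by (simp add: mod_add_eq)
    also have "\<dots> = sum_mset (add_mset x N) mod p" by (simp add: W(3) b(2) mod_add_right_eq)
    finally show ?case using W b by (intro exI[of _ "add_mset b W"]) auto
  qed (intro exI[of _ "{#}"], simp)
  show ?thesis
  proof (cases "?A \<subseteq> {0}")
    \<comment> \<open>The action is trivial: no nonzero residue starts the growth, but every sum is
      0 and the empty multiset is enough.\<close>
    case True
    have "(\<Sum>b\<in>#M. a b) mod p = 0"
      using M
    proof (induction M)
      case (add b M)
      then have "p dvd a b" "p dvd (\<Sum>b\<in>#M. a b)" using True by auto
      then show ?case by simp
    qed simp
    then show ?thesis by (intro exI[of _ "{#}"]) simp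
  next
    case False
    then obtain c where c: "c \<in> ?A" "c \<noteq> 0" by blast
    moreover have "c < p" using c(1) p0 by auto
    ultimately have "\<not> p dvd c" by (simp add: nat_dvd_not_less)
    have "p - 1 \<le> card (power_trace ` {0<..<p}) * card multiplicity_stabilizer"
      by (rule card_power_traces)
    also have "\<dots> \<le> d * card multiplicity_stabilizer"
      using card_power_traces_le_rat_degree d by (intro mult_right_mono) auto
    finally have card: "p - 1 \<le> d * card multiplicity_stabilizer" .
    have "residue_sums p ?A d = {..<p}"
    proof (rule residue_sums_eq[OF p _ _ c(1) \<open>\<not> p dvd c\<close> card])
      show "multiplicity_stabilizer \<subseteq> {0<..<p}" by (auto simp: multiplicity_stabilizer_def)
      fix h r assume h: "h \<in> multiplicity_stabilizer" and r: "r \<in> ?A"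
      \<comment> \<open>A residue occurs exactly when its multiplicity is nonzero, so preserving
        multiplicities preserves \<open>?A\<close>.\<close>
      then have "{b \<in> B. a b mod p = r mod p} \<noteq> {}" by auto
      then have "card {b \<in> B. a b mod p = h * r mod p} \<noteq> 0"
        using h B by (simp add: multiplicity_stabilizer_def)
      then obtain b where "b \<in> B" "a b mod p = h * r mod p" by (metis (mono_tags, lifting) card.empty empty_Collect_eq)
      then show "h * r mod p \<in> ?A" by (metis imageI)
    qed
    then have "(\<Sum>b\<in>#M. a b) mod p \<in> residue_sums p ?A d" using p0 by simp
    then obtain N where "set_mset N \<subseteq> ?A" "size N \<le> d" "(\<Sum>b\<in>#M. a b) mod p = sum_mset N mod p"
      unfolding residue_sums_def by blast
    then show ?thesis using lift[of N] by metis
  qed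
qed

end

section \<open>Diagonalising a cyclic group\<close>

lemma sum_root_of_unity_powers:
  assumes "p > 0" "0 < i" "i < p"
  shows "(\<Sum>j<p. inverse (root_of_unity p) ^ (j * i)) = 0"
proof -
  let ?w = "inverse (root_of_unity p) ^ i"
  have "?w = inverse (root_of_unity p ^ i)" by (rule power_inverse)
  moreover have "root_of_unity p ^ i \<noteq> 1"
    using assms by (simp add: root_of_unity_power_eq_1_iff nat_dvd_not_less)
  ultimately have "?w \<noteq> 1" by (metis inverse_1 inverse_inverse_eq)
  moreover have "?w ^ p = inverse (root_of_unity p ^ (i * p))"
    by (simp only: power_inverse power_mult)
  then have "?w ^ p = 1" using root_of_unity_power_eq_1_iff[OF assms(1), of "i * p"] by simp
  ultimately show ?thesis
    using geometric_sum[of ?w p] by (simp add: mult.commute[of _ i] power_mult del: cis_inverse)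
qed

text \<open>\<open>P j\<close> is \<open>p\<close> times the projection onto the eigenvalue zeta^j:
  by periodicity, applying \<open>T\<close> shifts the defining sum cyclically. Summed over
  \<open>j\<close>, only the term with i = 0 remains, so that \<open>v\<close> is recovered up to
  the factor \<open>p\<close>.\<close>

lemma eigenvectors_span:
  fixes T :: "'v::complex_vector \<Rightarrow> 'v"
  assumes p: "p > 0" and T: "clinear T" and period: "\<And>v. (T ^^ p) v = v"
  shows "cvec.span {v. \<exists>j<p. T v = root_of_unity p ^ j *\<^sub>C v} = UNIV" (is "cvec.span ?E = _")
proof -
  interpret T: Vector_Spaces.linear scaleC scaleC T by (rule T)
  let ?z = "root_of_unity p" and ?w = "inverse (root_of_unity p)"
  define P where "P j v = (\<Sum>i<p. ?w ^ (j * i) *\<^sub>C (T ^^ i) v)" for j v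
  have zw: "?z ^ j * ?w ^ j = 1" for j by (simp add: power_inverse del: cis_inverse)
  have wp: "?w ^ (j * p) = 1" for j
    using root_of_unity_power_eq_1_iff[OF p, of "j * p"] by (simp add: power_inverse del: cis_inverse)
  have "T (P j v) = ?z ^ j *\<^sub>C P j v" for j v
  proof -
    let ?f = "\<lambda>i. ?w ^ (j * i) *\<^sub>C (T ^^ i) v"
    have "T (P j v) = (\<Sum>i<p. ?z ^ j *\<^sub>C ?f (Suc i))"
      unfolding P_def T.sum T.scale
    proof (rule sum.cong[OF refl])
      fix i
      have "?z ^ j * ?w ^ (j * Suc i) = (?z ^ j * ?w ^ j) * ?w ^ (j * i)"
        by (simp add: power_add mult.assoc del: cis_inverse)
      then show "?w ^ (j * i) *\<^sub>C T ((T ^^ i) v) = ?z ^ j *\<^sub>C ?f (Suc i)"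
        by (simp only: scaleC_scaleC zw funpow.simps o_apply mult_1)
    qed
    also have "\<dots> = ?z ^ j *\<^sub>C (\<Sum>i<p. ?f (Suc i))" by (rule cvec.scale_sum_right[symmetric])
    also have "(\<Sum>i<p. ?f (Suc i)) = (\<Sum>i<p. ?f i)"
    proof -
      have "?f 0 + (\<Sum>i<p. ?f (Suc i)) = (\<Sum>i<p. ?f i) + ?f p"
        using sum.lessThan_Suc_shift[of ?f p] sum.lessThan_Suc[of ?f p] by simp
      moreover have "?f p = ?f 0" by (simp only: wp period mult_0_right power_0 funpow_0 funpow.simps id_apply)
      ultimately show ?thesis by (simp only: add.commute[of "?f 0"] add_right_cancel)
    qed
    finally show ?thesis by (simp only: P_def)
  qed
  then have PE: "j < p \<Longrightarrow> P j v \<in> ?E" for j v by blast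
  have "v \<in> cvec.span ?E" for v
  proof -
    have "(\<Sum>j<p. P j v) = (\<Sum>i<p. (\<Sum>j<p. ?w ^ (j * i)) *\<^sub>C (T ^^ i) v)"
      unfolding P_def by (subst sum.swap) (simp only: cvec.scale_sum_left)
    also have "\<dots> = (\<Sum>i<p. if i = 0 then of_nat p *\<^sub>C v else 0)"
      using sum_root_of_unity_powers[OF p]
      by (intro sum.cong) (auto simp del: cis_inverse)
    also have "\<dots> = of_nat p *\<^sub>C v" using p by simp
    finally have "v = inverse (of_nat p) *\<^sub>C (\<Sum>j<p. P j v)"
      using p by (simp add: scaleC_one)
    also have "\<dots> \<in> cvec.span ?E"
      using PE by (intro cvec.span_scale cvec.span_sum cvec.span_base) auto
    finally show ?thesis .
  qed
  then show ?thesis by blast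
qed

lemma (in complex_representation) action_pow:
  assumes "g \<in> carrier G" shows "\<rho> (g [^]\<^bsub>G\<^esub> n) v = (\<rho> g ^^ n) v"
  using assms by (induction n arbitrary: v) (simp_all add: action_mult funpow_swap1)

lemma (in complex_representation) character_eq_sum_eigenvalues:
  assumes B: "finite B" "cvec.independent B" "cvec.span B = UNIV" and g: "g \<in> carrier G"
    and eigen: "\<And>b. b \<in> B \<Longrightarrow> \<rho> g b = c b *\<^sub>C b"
  shows "character \<rho> g = (\<Sum>b\<in>B. c b)"
proof -
  have "character \<rho> g = (\<Sum>b\<in>B. cvec.representation B (\<rho> g b) b)"
    unfolding character_def using linear[OF g] B by (rule ctrace_eq)
  also have "\<dots> = (\<Sum>b\<in>B. c b)"
    using B by (intro sum.cong) (simp_all add: eigen cvec.representation_scale cvec.representation_basis cvec.span_base)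
  finally show ?thesis .
qed

lemma (in complex_representation) cyclic_eigenbasis:
  assumes x: "x \<in> carrier G" and p: "Coset.order G = p" "p > 0" and fin: "finite_dim TYPE('v)"
  obtains B :: "'v set" and a :: "'v \<Rightarrow> nat" where
    "finite B" "cvec.independent B" "cvec.span B = UNIV"
    "\<And>n b. b \<in> B \<Longrightarrow> \<rho> (x [^]\<^bsub>G\<^esub> n) b = root_of_unity p ^ (n * a b) *\<^sub>C b"
proof -
  let ?E = "{v. \<exists>j<p. \<rho> x v = root_of_unity p ^ j *\<^sub>C v}"
  have "(\<rho> x ^^ p) v = v" for v
    using pow_order_eq_1[OF x] p action_pow[OF x, of p v] by simp
  then have span: "cvec.span ?E = UNIV" by (rule eigenvectors_span[OF p(2) linear[OF x]])
  obtain B where B: "B \<subseteq> ?E" "cvec.independent B" "?E \<subseteq> cvec.span B"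
    by (rule cvec.maximal_independent_subset)
  have spanB: "cvec.span B = UNIV"
    using cvec.span_mono[OF B(3)] span by (simp add: cvec.span_span top.extremum_unique)
  obtain C :: "'v set" where "finite C" "cvec.span C = UNIV" using fin by (auto simp: finite_dim_def)
  then have finB: "finite B" using cvec.independent_span_bound[of C B] B(2) by blast
  have "\<forall>b\<in>B. \<exists>j. \<rho> x b = root_of_unity p ^ j *\<^sub>C b" using B(1) by blast
  then obtain a where a: "\<And>b. b \<in> B \<Longrightarrow> \<rho> x b = root_of_unity p ^ a b *\<^sub>C b" by metis
  interpret T: Vector_Spaces.linear scaleC scaleC "\<rho> x" using x by (rule linear)
  have "\<rho> (x [^]\<^bsub>G\<^esub> n) b = root_of_unity p ^ (n * a b) *\<^sub>C b" if b: "b \<in> B" for n b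
    unfolding action_pow[OF x]
  proof (induction n)
    case (Suc n)
    then show ?case using a[OF b] by (simp add: T.scale power_add mult.commute)
  qed (simp add: scaleC_one)
  with finB B(2) spanB show thesis by (rule that)
qed

theorem proposition5p1:
  fixes p :: nat
    and G :: "('g, 'm) monoid_scheme"
    and \<rho> :: "'g \<Rightarrow> 'v::complex_vector \<Rightarrow> 'v"
  assumes "prime p" and "odd p"
    and "group G" and "cyclic_group G" and "Coset.order G = p"
    and "complex_representation G \<rho>" and "finite_dim TYPE('v)"
  shows "field_noether_number G \<rho> \<le> 2 * rat_degree (rat_adjoin (character \<rho> ` carrier G)) + 1"
proof -
  interpret complex_representation G \<rho> by fact
  have p0: "p > 0" using \<open>prime p\<close> by (rule prime_gt_0_nat)
  have finG: "finite (carrier G)" using p0 \<open>Coset.order G = p\<close> order_gt_0_iff_finite by blast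
  obtain x where x: "x \<in> carrier G" "subgroup_generated G {x} = G"
    using \<open>cyclic_group G\<close> by (auto simp: cyclic_group_def)
  have "carrier G = generate G {x}"
    using x carrier_subgroup_generated[of G "{x}"] by simp
  then have gen: "carrier G = range (\<lambda>n::nat. x [^]\<^bsub>G\<^esub> n)"
    unfolding generate_pow_on_finite_carrier[OF finG x(1)] by auto
  obtain B :: "'v set" and a where B: "finite B" "cvec.independent B" "cvec.span B = UNIV"
    and a: "\<And>n b. b \<in> B \<Longrightarrow> \<rho> (x [^]\<^bsub>G\<^esub> n) b = root_of_unity p ^ (n * a b) *\<^sub>C b"
    using cyclic_eigenbasis[OF x(1) \<open>Coset.order G = p\<close> p0 \<open>finite_dim TYPE('v)\<close>] by blast
  have pow: "x [^]\<^bsub>G\<^esub> n \<in> carrier G" for n :: nat using x(1) by simp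
  have char: "character \<rho> (x [^]\<^bsub>G\<^esub> n) = power_trace p B a n" for n :: nat
    unfolding power_trace_def[OF \<open>prime p\<close> B(1)]
    using character_eq_sum_eigenvalues[OF B pow a] .
  have chars: "character \<rho> ` carrier G = range (power_trace p B a)"
    unfolding gen image_image char ..
  \<comment> \<open>Reading the eigenvalue off as a coefficient avoids choosing an exponent for each
    group element.\<close>
  define \<theta> where "\<theta> b g = cvec.representation B (\<rho> g b) b" for b g
  have \<theta>: "\<theta> b (x [^]\<^bsub>G\<^esub> n) = root_of_unity p ^ (n * a b)" if "b \<in> B" for b and n :: nat
    using B that by (simp add: \<theta>_def a cvec.representation_scale cvec.representation_basis cvec.span_base)
  interpret diagonal_representation G \<rho> B \<theta>
  proof
    show "\<rho> g b = \<theta> b g *\<^sub>C b" if "g \<in> carrier G" "b \<in> B" for g b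
      using that \<theta> a unfolding gen by auto
  qed (use B finG in auto)
  have weight: "weight M (x [^]\<^bsub>G\<^esub> n) = root_of_unity p ^ (n * (\<Sum>b\<in>#M. a b))"
    if "set_mset M \<subseteq> B" for M and n :: nat
    using that by (induction M) (simp_all add: \<theta> power_add distrib_left)
  let ?d = "rat_degree (rat_adjoin (character \<rho> ` carrier G))"
  have "complex_adjoin (ratfun_of ` invariant_polys_upto G \<rho> (2 * ?d + 1)) = invariant_ratfuns G \<rho>"
  proof (rule invariant_ratfuns_generated)
    fix M assume M: "set_mset M \<subseteq> B"
    obtain W where W: "set_mset W \<subseteq> B" "size W \<le> ?d"
      "(\<Sum>b\<in>#W. a b) mod p = (\<Sum>b\<in>#M. a b) mod p"
      using short_congruent_multiset[OF \<open>prime p\<close> B(1) _ M, of a ?d] unfolding chars by auto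
    have "weight W g = weight M g" if "g \<in> carrier G" for g
    proof -
      obtain n :: nat where "g = x [^]\<^bsub>G\<^esub> n" using \<open>g \<in> carrier G\<close> unfolding gen by blast
      \<comment> \<open>Congruence of the weights of the generator suffices, since passing to its
        \<open>n\<close>-th power multiplies both by \<open>n\<close>.\<close>
      moreover have "n * (\<Sum>b\<in>#W. a b) mod p = n * (\<Sum>b\<in>#M. a b) mod p"
        using W(3) by (metis mod_mult_right_eq)
      ultimately show ?thesis
        using M W(1) by (simp add: weight root_of_unity_power_eq_iff[OF p0])
    qed
    then show "\<exists>W. set_mset W \<subseteq> B \<and> size W \<le> ?d \<and> (\<forall>g\<in>carrier G. weight W g = weight M g)"
      using W by blast
  qed
  then show ?thesis unfolding field_noether_number_def by (rule Least_le)
qed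

end
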